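(* Let $0\le q\le1$ and consider the problem $$(\mathcal{A}^q)\quad \min_{X\in L^2_{\mathcal F_T}(\Omega;\mathbb R)} \mathrm{E}\big[(\gamma-X)_+^q\big]\quad\text{subject to}\quad \mathrm{E}[X]\ge d,\ \ \mathrm{E}[z(T)X]=x_0,\ \ 0\le X\le B .$$ For $\eta>0$, $\lambda\ge0$ put $$X_{\lambda,\eta}:=(B-\gamma)\mathbf 1_{\eta z(T)\le\lambda}+\gamma\,\mathbf 1_{\eta z(T)\le\lambda+\gamma^{q-1}} .$$ Then the following hold. (i) If $\underline d<d<\bar d$, then $X_{\lambda,\eta}$ solves $(\mathcal A^q)$, and there is a unique pair $\lambda>0$, $\eta>0$ satisfying $\mathrm E[X_{\lambda,\eta}]=d$ and $\mathrm E[z(T)X_{\lambda,\eta}]=x_0$. (ii) If $d\le\underline d$ and $x_0<\gamma\,\mathrm E[z(T)]$, then $X_{\lambda,\eta}$ solves $(\mathcal A^q)$ with $\lambda=0$ and $\eta=\gamma^{q-1}/H_1^{-1}(x_0/\gamma)$, and this pair satisfies $\mathrm E[X_{\lambda,\eta}]\ge d$ and $\mathrm E[z(T)X_{\lambda,\eta}]=x_0$. (iii) If $d\le\underline d$ and $x_0\ge\gamma\,\mathrm E[z(T)]$, then the set $$\mathcal X:=\{Y\in L^2_{\mathcal F_T}(\Omega;\mathbb R)\mid \gamma\le Y\le B,\ \mathrm E[Y]\ge d,\ \mathrm E[z(T)Y]=x_0\}$$ is nonempty and any $X\in\mathcal X$ is a solution of $(\mathcal A^q)$; one such solution is $$x^*(T)=(B-\gamma)\mathbf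 1_{z(T)\le H_1^{-1}\left(\frac{x_0-\gamma \mathrm E[z(T)]}{B-\gamma}\right)}+\gamma .$$
   Context: $(\Omega,\mathcal F,\mathbb P,\{\mathcal F_t\})$ is a complete filtered probability space carrying an $n$-dimensional Brownian motion $W$. The market has a risk-free asset with adapted rate $r(t)$ and $n$ risky assets with adapted, uniformly bounded drifts $\mu_i(t)$ and volatilities $\sigma_{ij}(t)$, the matrix $\sigma(t)=(\sigma_{ij}(t))$ satisfying $\sigma(t)\sigma(t)'\succ\epsilon I$ for all $t\in[0,T]$ and some $\epsilon>0$; $b(t)=(\mu_1(t)-r(t),\dots,\mu_n(t)-r(t))'$, $\theta(t)=\sigma(t)^{-1}b(t)$, and the state price density is $$z(t)=\exp\Big\{-\int_0^t\big(r(s)+\tfrac12\|\theta(s)\|^2\big)ds-\int_0^t\theta(s)'dW(s)\Big\}.$$ $L^2_{\mathcal F_T}(\Omega;\mathbb R)$ is the set of square integrable $\mathcal F_T$-measurable real random variables; $(a)_+=a\mathbf 1_{a\ge0}$, $(a)_+^q=((a)_+)^q$, and for $q=0$ one has $(\gamma-X)_+^0=\mathbf 1_{X\le\gamma}$, so that the objective is $\mathbb P(X\le\gamma)$. Parameters: initial wealth $x_0$, target $d$, a given benchmark level $\gamma\in\mathbb R$, $q$ a given nonnegative integer, and upper bound $B>\max\{d,\bar x_T,\gamma\}$, where $\bar x_T$ is a given safe level of terminal wealth (e.g. $\bar x_T=\mathrm E[e^{\int_0^Tr(s)ds}]x_0$). For $y>0$ let $H_0(y)=\mathbb P(z(T)\le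 y)$ and $H_1(y)=\mathrm E[z(T)\mathbf 1_{z(T)\le y}]$; $H_1^{-1}$ is the inverse function of $H_1$. For $0\le q\le1$, $$\underline d=\begin{cases}\gamma H_0\big(H_1^{-1}(x_0/\gamma)\big), & x_0<\gamma\mathrm E[z(T)],\\ (B-\gamma)H_0\Big(H_1^{-1}\Big(\frac{x_0-\gamma\mathrm E[z(T)]}{B-\gamma}\Big)\Big)+\gamma,& x_0\ge\gamma\mathrm E[z(T)],\end{cases}\qquad \bar d=B\,H_0\big(H_1^{-1}(x_0/B)\big).$$
   Formalization: For q=0 the objective is P(X<γ) instead of P(X≤γ), under which the stated solutions are not optimal; (iii) assumes γ≥0, since for γ<0 x*(T) violates X≥0; E[z(T)]<∞ and 0<x_0<B·E[z(T)] are made explicit so that H_1^{-1} is defined. *)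

theory Defs
  imports "HOL-Probability.Probability" "HOL-Probability.Conditional_Expectation"
    "HOL-Probability.Stopping_Time"
begin

section \<open>Filtered probability space and Brownian motion\<close>

text \<open>The library's filtrations are indexed by a whole type, here the real line. Only the indices
in \<open>[0,T]\<close> are used below; a filtration on \<open>[0,T]\<close> can be extended by constants.\<close>

locale complete_filtered_prob_space =
  prob_space M + complete_measure M + filtration "space M" F
  for M :: "'a measure" and F :: "real \<Rightarrow> 'a measure" +
  assumes subalgebra_F: "\<And>t. subalgebra M (F t)"
    and null_sets_F: "null_sets M \<subseteq> sets (F 0)"

definition progressively_measurable ::
  "(real \<Rightarrow> 'a measure) \<Rightarrow> real \<Rightarrow> (real \<Rightarrow> 'a \<Rightarrow> 'b::topological_space) \<Rightarrow> bool" where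
  "progressively_measurable F T X \<longleftrightarrow>
     (\<forall>t\<in>{0..T}. (\<lambda>(s, \<omega>). X s \<omega>) \<in> borel_measurable (restrict_space borel {0..t} \<Otimes>\<^sub>M F t))"

definition brownian_motion ::
  "'a measure \<Rightarrow> (real \<Rightarrow> 'a measure) \<Rightarrow> real \<Rightarrow> (real \<Rightarrow> 'a \<Rightarrow> real ^ 'n) \<Rightarrow> bool" where
  "brownian_motion M F T W \<longleftrightarrow>
     (\<forall>t\<in>{0..T}. W t \<in> borel_measurable (F t)) \<and>
     (AE \<omega> in M. W 0 \<omega> = 0) \<and>
     (AE \<omega> in M. continuous_on {0..T} (\<lambda>t. W t \<omega>)) \<and>
     (\<forall>s t. 0 \<le> s \<and> s < t \<and> t \<le> T \<longrightarrow>
        prob_space.indep_set M (sets (F s))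
          {(\<lambda>\<omega>. W t \<omega> - W s \<omega>) -` A \<inter> space M | A. A \<in> sets borel} \<and>
        prob_space.indep_vars M (\<lambda>_. borel) (\<lambda>i \<omega>. (W t \<omega> - W s \<omega>) $ i) UNIV \<and>
        (\<forall>i. distributed M lborel (\<lambda>\<omega>. (W t \<omega> - W s \<omega>) $ i) (normal_density 0 (sqrt (t - s)))))"

section \<open>Stochastic integral\<close>

text \<open>A simple process is given by \<open>m\<close>, grid points \<open>\<tau> 0 \<le> \<dots> \<le> \<tau> m\<close> and bounded,
\<open>F (\<tau> j)\<close>-measurable values \<open>h j\<close> on \<open>(\<tau> j, \<tau> (j + 1)]\<close>.\<close>

definition simple_process ::
  "(real \<Rightarrow> 'a measure) \<Rightarrow> nat \<Rightarrow> (nat \<Rightarrow> real) \<Rightarrow> (nat \<Rightarrow> 'a \<Rightarrow> real ^ 'n) \<Rightarrow> bool" where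
  "simple_process F m \<tau> h \<longleftrightarrow>
     0 \<le> \<tau> 0 \<and>
     (\<forall>j<m. \<tau> j \<le> \<tau> (Suc j) \<and> h j \<in> borel_measurable (F (\<tau> j)) \<and>
            (\<exists>C. \<forall>\<omega>\<in>space (F (\<tau> j)). norm (h j \<omega>) \<le> C))"

definition simple_value ::
  "nat \<Rightarrow> (nat \<Rightarrow> real) \<Rightarrow> (nat \<Rightarrow> 'a \<Rightarrow> real ^ 'n) \<Rightarrow> real \<Rightarrow> 'a \<Rightarrow> real ^ 'n" where
  "simple_value m \<tau> h s \<omega> = (\<Sum>j<m. indicator {\<tau> j <.. \<tau> (Suc j)} s *\<^sub>R h j \<omega>)"

definition simple_integral ::
  "(real \<Rightarrow> 'a \<Rightarrow> real ^ 'n) \<Rightarrow> nat \<Rightarrow> (nat \<Rightarrow> real) \<Rightarrow> (nat \<Rightarrow> 'a \<Rightarrow> real ^ 'n) \<Rightarrow> real \<Rightarrow> 'a \<Rightarrow> real" where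
  "simple_integral W m \<tau> h t \<omega> =
     (\<Sum>j<m. h j \<omega> \<bullet> (W (min t (\<tau> (Suc j))) \<omega> - W (min t (\<tau> j)) \<omega>))"

definition tendsto_in_prob :: "'a measure \<Rightarrow> (nat \<Rightarrow> 'a \<Rightarrow> real) \<Rightarrow> ('a \<Rightarrow> real) \<Rightarrow> bool" where
  "tendsto_in_prob M X Y \<longleftrightarrow>
     (\<forall>e>0. (\<lambda>k. measure M {\<omega> \<in> space M. e < \<bar>X k \<omega> - Y \<omega>\<bar>}) \<longlonglongrightarrow> 0)"

text \<open>\<open>J\<close> is a version of the Ito integral of \<open>\<phi>' dW\<close> over \<open>[0,t]\<close>, for progressively measurable
\<open>\<phi>\<close> with almost surely square integrable paths: a limit in probability of integrals of simple
processes approximating \<open>\<phi>\<close>. This determines \<open>J\<close> up to null sets.\<close>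

definition has_ito_integral ::
  "'a measure \<Rightarrow> (real \<Rightarrow> 'a measure) \<Rightarrow> (real \<Rightarrow> 'a \<Rightarrow> real ^ 'n) \<Rightarrow>
   (real \<Rightarrow> 'a \<Rightarrow> real ^ 'n) \<Rightarrow> real \<Rightarrow> ('a \<Rightarrow> real) \<Rightarrow> bool" where
  "has_ito_integral M F W \<phi> t J \<longleftrightarrow>
     J \<in> borel_measurable (F t) \<and>
     (AE \<omega> in M. set_integrable lborel {0..t} (\<lambda>s. (norm (\<phi> s \<omega>))\<^sup>2)) \<and>
     (\<exists>m \<tau> h. (\<forall>k. simple_process F (m k) (\<tau> k) (h k)) \<and>
        tendsto_in_prob M
          (\<lambda>k \<omega>. LBINT s:{0..t}. (norm (simple_value (m k) (\<tau> k) (h k) s \<omega> - \<phi> s \<omega>))\<^sup>2) (\<lambda>_. 0) \<and>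
        tendsto_in_prob M (\<lambda>k. simple_integral W (m k) (\<tau> k) (h k) t) J)"

section \<open>Market\<close>

definition pos_def :: "real ^ 'n ^ 'n \<Rightarrow> bool" where
  "pos_def A \<longleftrightarrow> transpose A = A \<and> (\<forall>x. x \<noteq> 0 \<longrightarrow> x \<bullet> (A *v x) > 0)"

definition excess_return ::
  "(real \<Rightarrow> 'a \<Rightarrow> real) \<Rightarrow> (real \<Rightarrow> 'a \<Rightarrow> real ^ 'n) \<Rightarrow> real \<Rightarrow> 'a \<Rightarrow> real ^ 'n" where
  "excess_return r \<mu> t \<omega> = (\<chi> i. \<mu> t \<omega> $ i - r t \<omega>)"

definition risk_price ::
  "(real \<Rightarrow> 'a \<Rightarrow> real) \<Rightarrow> (real \<Rightarrow> 'a \<Rightarrow> real ^ 'n) \<Rightarrow> (real \<Rightarrow> 'a \<Rightarrow> real ^ 'n ^ 'n) \<Rightarrow>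
   real \<Rightarrow> 'a \<Rightarrow> real ^ 'n" where
  "risk_price r \<mu> \<sigma> t \<omega> = matrix_inv (\<sigma> t \<omega>) *v excess_return r \<mu> t \<omega>"

text \<open>The process \<open>I\<close> is the stochastic integral of \<open>\<theta>' dW\<close>, \<open>\<theta> = risk_price r \<mu> \<sigma>\<close>. The rate \<open>r\<close>
is not assumed bounded; only the integrals in the state price density have to exist.\<close>

locale market = complete_filtered_prob_space M F
  for M :: "'a measure" and F :: "real \<Rightarrow> 'a measure" +
  fixes T :: real
    and W :: "real \<Rightarrow> 'a \<Rightarrow> real ^ 'n"
    and r :: "real \<Rightarrow> 'a \<Rightarrow> real"
    and \<mu> :: "real \<Rightarrow> 'a \<Rightarrow> real ^ 'n"
    and \<sigma> :: "real \<Rightarrow> 'a \<Rightarrow> real ^ 'n ^ 'n"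
    and I :: "real \<Rightarrow> 'a \<Rightarrow> real"
  assumes T_pos: "0 < T"
    and W_brownian: "brownian_motion M F T W"
    and r_prog: "progressively_measurable F T r"
    and \<mu>_prog: "progressively_measurable F T \<mu>"
    and \<sigma>_prog: "progressively_measurable F T \<sigma>"
    and \<mu>_bounded: "\<exists>C. \<forall>t\<in>{0..T}. \<forall>\<omega>\<in>space M. \<forall>i. \<bar>\<mu> t \<omega> $ i\<bar> \<le> C"
    and \<sigma>_bounded: "\<exists>C. \<forall>t\<in>{0..T}. \<forall>\<omega>\<in>space M. \<forall>i j. \<bar>\<sigma> t \<omega> $ i $ j\<bar> \<le> C"
    and nondegenerate: "\<exists>\<epsilon>>0. \<forall>t\<in>{0..T}. \<forall>\<omega>\<in>space M.
          pos_def (\<sigma> t \<omega> ** transpose (\<sigma> t \<omega>) - \<epsilon> *\<^sub>R mat 1)"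
    and r_integrable: "AE \<omega> in M. set_integrable lborel {0..T} (\<lambda>s. r s \<omega>)"
    and I_integral: "\<forall>t\<in>{0..T}. has_ito_integral M F W (risk_price r \<mu> \<sigma>) t (I t)"

definition state_price_density ::
  "(real \<Rightarrow> 'a \<Rightarrow> real) \<Rightarrow> (real \<Rightarrow> 'a \<Rightarrow> real ^ 'n) \<Rightarrow> (real \<Rightarrow> 'a \<Rightarrow> real ^ 'n ^ 'n) \<Rightarrow>
   (real \<Rightarrow> 'a \<Rightarrow> real) \<Rightarrow> real \<Rightarrow> 'a \<Rightarrow> real" where
  "state_price_density r \<mu> \<sigma> I t \<omega> =
     exp (- (LBINT s:{0..t}. r s \<omega> + 1 / 2 * (norm (risk_price r \<mu> \<sigma> s \<omega>))\<^sup>2) - I t \<omega>)"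

section \<open>The portfolio problem\<close>

text \<open>\<open>Z\<close> stands for the state price density at time \<open>T\<close>.\<close>

definition H0 :: "'a measure \<Rightarrow> ('a \<Rightarrow> real) \<Rightarrow> real \<Rightarrow> real" where
  "H0 M Z y = measure M {\<omega> \<in> space M. Z \<omega> \<le> y}"

definition H1 :: "'a measure \<Rightarrow> ('a \<Rightarrow> real) \<Rightarrow> real \<Rightarrow> real" where
  "H1 M Z y = (LINT \<omega>|M. Z \<omega> * indicator {..y} (Z \<omega>))"

text \<open>The point \<open>0\<close> is added to the domain of \<open>H1\<close> so that the inverse is also meaningful at the
value \<open>0\<close>, which is its argument in the boundary case \<open>x0 = \<gamma> E[Z]\<close>.\<close>

definition H1_inv :: "'a measure \<Rightarrow> ('a \<Rightarrow> real) \<Rightarrow> real \<Rightarrow> real" where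
  "H1_inv M Z = inv_into {0..} (H1 M Z)"

definition d_lower :: "'a measure \<Rightarrow> ('a \<Rightarrow> real) \<Rightarrow> real \<Rightarrow> real \<Rightarrow> real \<Rightarrow> real" where
  "d_lower M Z x0 \<gamma> B =
     (if x0 < \<gamma> * (LINT \<omega>|M. Z \<omega>) then \<gamma> * H0 M Z (H1_inv M Z (x0 / \<gamma>))
      else (B - \<gamma>) * H0 M Z (H1_inv M Z ((x0 - \<gamma> * (LINT \<omega>|M. Z \<omega>)) / (B - \<gamma>))) + \<gamma>)"

definition d_upper :: "'a measure \<Rightarrow> ('a \<Rightarrow> real) \<Rightarrow> real \<Rightarrow> real \<Rightarrow> real" where
  "d_upper M Z x0 B = B * H0 M Z (H1_inv M Z (x0 / B))"

definition L2_set :: "'a measure \<Rightarrow> 'a measure \<Rightarrow> ('a \<Rightarrow> real) set" where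
  "L2_set M G = {X. X \<in> borel_measurable G \<and> integrable M (\<lambda>\<omega>. (X \<omega>)\<^sup>2)}"

text \<open>For \<open>q = 0\<close> the power is the indicator of \<open>a > 0\<close>, so that the objective is \<open>P(X < \<gamma>)\<close>. With
the indicator of \<open>a \<ge> 0\<close> instead, i.e. with the objective \<open>P(X \<le> \<gamma>)\<close>, a wealth equal to \<open>\<gamma>\<close>
would be penalised like a smaller one and the payoff \<open>X_opt\<close> below would not be optimal.\<close>

definition pos_part_power :: "nat \<Rightarrow> real \<Rightarrow> real" where
  "pos_part_power q a = (if q = 0 then indicator {0<..} a else (max a 0) ^ q)"

definition objective :: "'a measure \<Rightarrow> nat \<Rightarrow> real \<Rightarrow> ('a \<Rightarrow> real) \<Rightarrow> real" where
  "objective M q \<gamma> X = (LINT \<omega>|M. pos_part_power q (\<gamma> - X \<omega>))"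

definition feasible ::
  "'a measure \<Rightarrow> 'a measure \<Rightarrow> ('a \<Rightarrow> real) \<Rightarrow> real \<Rightarrow> real \<Rightarrow> real \<Rightarrow> ('a \<Rightarrow> real) set" where
  "feasible M G Z x0 d B = {X \<in> L2_set M G.
     (LINT \<omega>|M. X \<omega>) \<ge> d \<and> (LINT \<omega>|M. Z \<omega> * X \<omega>) = x0 \<and> (AE \<omega> in M. 0 \<le> X \<omega> \<and> X \<omega> \<le> B)}"

definition solves ::
  "'a measure \<Rightarrow> 'a measure \<Rightarrow> ('a \<Rightarrow> real) \<Rightarrow> nat \<Rightarrow> real \<Rightarrow> real \<Rightarrow> real \<Rightarrow> real \<Rightarrow> ('a \<Rightarrow> real) \<Rightarrow> bool"
  where
  "solves M G Z q \<gamma> x0 d B X \<longleftrightarrow>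
     X \<in> feasible M G Z x0 d B \<and>
     (\<forall>Y\<in>feasible M G Z x0 d B. objective M q \<gamma> X \<le> objective M q \<gamma> Y)"

definition X_opt ::
  "('a \<Rightarrow> real) \<Rightarrow> nat \<Rightarrow> real \<Rightarrow> real \<Rightarrow> real \<Rightarrow> real \<Rightarrow> 'a \<Rightarrow> real" where
  "X_opt Z q \<gamma> B l \<eta> \<omega> =
     (B - \<gamma>) * indicator {..l} (\<eta> * Z \<omega>) +
     \<gamma> * indicator {..l + \<gamma> powi (int q - 1)} (\<eta> * Z \<omega>)"

definition safe_set ::
  "'a measure \<Rightarrow> 'a measure \<Rightarrow> ('a \<Rightarrow> real) \<Rightarrow> real \<Rightarrow> real \<Rightarrow> real \<Rightarrow> real \<Rightarrow> ('a \<Rightarrow> real) set" where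
  "safe_set M G Z \<gamma> x0 d B = {Y \<in> L2_set M G.
     (AE \<omega> in M. \<gamma> \<le> Y \<omega> \<and> Y \<omega> \<le> B) \<and> (LINT \<omega>|M. Y \<omega>) \<ge> d \<and> (LINT \<omega>|M. Z \<omega> * Y \<omega>) = x0}"

definition x_star :: "'a measure \<Rightarrow> ('a \<Rightarrow> real) \<Rightarrow> real \<Rightarrow> real \<Rightarrow> real \<Rightarrow> 'a \<Rightarrow> real" where
  "x_star M Z \<gamma> x0 B \<omega> =
     (B - \<gamma>) * indicator {..H1_inv M Z ((x0 - \<gamma> * (LINT \<omega>|M. Z \<omega>)) / (B - \<gamma>))} (Z \<omega>) + \<gamma>"

end

(* With multipliers l for the mean constraint and \<eta> for the budget constraint, X_opt minimises the
Lagrangian (\<gamma> - x)_+^q + (\<eta> Z - l) x over x in [0,B] pointwise, hence is optimal. It pays B on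
Z \<le> a, \<gamma> on a < Z \<le> b and 0 elsewhere, where a = l / \<eta> and b = (l + \<gamma>^(q-1)) / \<eta>, and this is
a bijection from multipliers l, \<eta> > 0 to thresholds 0 < a < b. Along the budget line, increasing
a forces b to decrease and strictly increases the mean, because a unit of mean costs at most the new
a in the states gained and at least the new b in those lost; this gives uniqueness. The
extreme positions of the thresholds on the budget line have means d_lower and d_upper, so existence
is the intermediate value theorem. For \<gamma> \<le> 0 the range d_lower < d < d_upper is empty. *)
theory Submission
  imports Defs
begin

section \<open>Measurability of the state price density\<close>

lemma det_borel_measurable:
  fixes A :: "'a \<Rightarrow> real ^ 'n ^ 'n"
  assumes "\<And>i j. (\<lambda>x. A x $ i $ j) \<in> borel_measurable N"
  shows "(\<lambda>x. det (A x)) \<in> borel_measurable N"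
  unfolding det_def using assms by measurable

lemma vec_component_borel_measurable:
  fixes f :: "'a \<Rightarrow> ('b::{euclidean_space}) ^ 'n"
  assumes "f \<in> borel_measurable N"
  shows "(\<lambda>x. f x $ i) \<in> borel_measurable N"
proof -
  have "continuous_on UNIV (\<lambda>v :: 'b ^ 'n. v $ i)"
    by (intro continuous_intros)
  then show ?thesis
    using borel_measurable_continuous_onI assms measurable_compose by blast
qed

lemma vec_lambda_borel_measurable:
  fixes f :: "'n::finite \<Rightarrow> 'a \<Rightarrow> real"
  assumes "\<And>k. f k \<in> borel_measurable N"
  shows "(\<lambda>x. \<chi> k. f k x) \<in> borel_measurable N"
  by (subst borel_measurable_euclidean_space) (auto simp: Basis_vec_def inner_axis assms)

text \<open>Cramer's rule makes the inverse matrix a quotient of polynomials in the entries.\<close>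

lemma matrix_inv_vector_borel_measurable:
  fixes A :: "'a \<Rightarrow> real ^ 'n ^ 'n" and b :: "'a \<Rightarrow> real ^ 'n"
  assumes "\<And>i j. (\<lambda>x. A x $ i $ j) \<in> borel_measurable N"
    and "\<And>i. (\<lambda>x. b x $ i) \<in> borel_measurable N"
    and "\<And>x. x \<in> space N \<Longrightarrow> invertible (A x)"
  shows "(\<lambda>x. matrix_inv (A x) *v b x) \<in> borel_measurable N"
proof -
  let ?c = "\<lambda>x. \<chi> k. det (\<chi> i j. if j = k then b x $ i else A x $ i $ j) / det (A x)"
  have "matrix_inv (A x) *v b x = ?c x" if "x \<in> space N" for x
  proof -
    have inv: "invertible (A x)"
      using assms(3) that .
    \<comment> \<open>\<open>matrix_inv\<close> is a Hilbert choice; invertibility is what makes it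
      an actual inverse.\<close>
    then have "A x *v (matrix_inv (A x) *v b x) = b x"
      using someI_ex[of "\<lambda>A'. A x ** A' = mat 1 \<and> A' ** A x = mat 1"]
      by (simp add: matrix_vector_mul_assoc matrix_inv_def invertible_def)
    then show ?thesis
      using cramer[of "A x"] inv invertible_det_nz by blast
  qed
  moreover have "?c \<in> borel_measurable N"
  proof (rule vec_lambda_borel_measurable)
    fix k
    have "(\<lambda>x. det (\<chi> i j. if j = k then b x $ i else A x $ i $ j)) \<in> borel_measurable N"
      using assms(1,2) by (intro det_borel_measurable) auto
    moreover have "(\<lambda>x. det (A x)) \<in> borel_measurable N"
      using assms(1) by (rule det_borel_measurable)
    ultimately show "(\<lambda>x. det (\<chi> i j. if j = k then b x $ i else A x $ i $ j) / det (A x))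
        \<in> borel_measurable N"
      by measurable
  qed
  ultimately show ?thesis
    by (subst measurable_cong) auto
qed

text \<open>On the kernel of the transpose the quadratic form equals -\<epsilon> times the squared
  norm, so positivity forces this kernel to be trivial.\<close>

lemma pos_def_imp_invertible:
  fixes A :: "real ^ 'n ^ 'n"
  assumes "0 < \<epsilon>" "pos_def (A ** transpose A - \<epsilon> *\<^sub>R mat 1)"
  shows "invertible A"
proof -
  have "x = 0" if "transpose A *v x = 0" for x
  proof (rule ccontr)
    assume "x \<noteq> 0"
    then have "0 < x \<bullet> ((A ** transpose A - \<epsilon> *\<^sub>R mat 1) *v x)"
      using assms(2) by (auto simp: pos_def_def)
    also have "\<dots> = - \<epsilon> * (x \<bullet> x)"
      using that by (simp add: matrix_vector_mult_diff_rdistrib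
          flip: matrix_vector_mul_assoc scaleR_matrix_vector_assoc)
    finally show False
      using assms(1) \<open>x \<noteq> 0\<close> by (metis inner_ge_zero mult_minus_left mult_nonneg_nonneg
          neg_less_0_iff_less not_less order_less_imp_le)
  qed
  then have "invertible (transpose A)"
    using matrix_left_invertible_ker invertible_left_inverse by blast
  then show ?thesis
    by (metis transpose_invertible transpose_transpose)
qed

text \<open>Joint measurability in time and state is what makes the time integral in the density a
  measurable function of the state.\<close>

lemma (in market) risk_price_borel_measurable:
  "(\<lambda>(s, \<omega>). risk_price r \<mu> \<sigma> s \<omega>) \<in> borel_measurable (restrict_space borel {0..T} \<Otimes>\<^sub>M F T)"
proof -
  let ?N = "restrict_space borel {0..T} \<Otimes>\<^sub>M F T"
  have T: "T \<in> {0..T}"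
    using T_pos by simp
  have [measurable]: "(\<lambda>x. case x of (s, \<omega>) \<Rightarrow> r s \<omega>) \<in> borel_measurable ?N"
    "(\<lambda>x. case x of (s, \<omega>) \<Rightarrow> \<mu> s \<omega>) \<in> borel_measurable ?N"
    "(\<lambda>x. case x of (s, \<omega>) \<Rightarrow> \<sigma> s \<omega>) \<in> borel_measurable ?N"
    using r_prog \<mu>_prog \<sigma>_prog T unfolding progressively_measurable_def by blast+
  have sp: "space (F T) = space M"
    using subalgebra_F by (simp add: subalgebra_def)
  obtain \<epsilon> where \<epsilon>: "\<epsilon> > 0" "\<And>t \<omega>. t \<in> {0..T} \<Longrightarrow> \<omega> \<in> space M \<Longrightarrow>
      pos_def (\<sigma> t \<omega> ** transpose (\<sigma> t \<omega>) - \<epsilon> *\<^sub>R mat 1)"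
    using nondegenerate by blast
  have "(\<lambda>x. matrix_inv (case x of (s, \<omega>) \<Rightarrow> \<sigma> s \<omega>) *v (case x of (s, \<omega>) \<Rightarrow> excess_return r \<mu> s \<omega>))
      \<in> borel_measurable ?N"
  proof (rule matrix_inv_vector_borel_measurable)
    fix i j
    show "(\<lambda>x. (case x of (s, \<omega>) \<Rightarrow> \<sigma> s \<omega>) $ i $ j) \<in> borel_measurable ?N"
      by (intro vec_component_borel_measurable) measurable
  next
    fix i
    have [measurable]: "(\<lambda>x. (case x of (s, \<omega>) \<Rightarrow> \<mu> s \<omega>) $ i) \<in> borel_measurable ?N"
      by (intro vec_component_borel_measurable) measurable
    have "(\<lambda>x. (case x of (s, \<omega>) \<Rightarrow> \<mu> s \<omega>) $ i - (case x of (s, \<omega>) \<Rightarrow> r s \<omega>)) \<in> borel_measurable ?N"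
      by measurable
    then show "(\<lambda>x. (case x of (s, \<omega>) \<Rightarrow> excess_return r \<mu> s \<omega>) $ i) \<in> borel_measurable ?N"
      by (simp add: excess_return_def case_prod_beta)
  next
    fix x assume "x \<in> space ?N"
    then show "invertible (case x of (s, \<omega>) \<Rightarrow> \<sigma> s \<omega>)"
      using pos_def_imp_invertible[OF \<epsilon>(1) \<epsilon>(2)] sp
      by (auto simp: space_pair_measure space_restrict_space)
  qed
  then show ?thesis
    by (simp add: risk_price_def case_prod_beta)
qed

text \<open>Through this, payoffs that are Borel functions of the terminal density, such as
  \<open>X_opt\<close> and \<open>x_star\<close>, are measurable at time \<open>T\<close> and can be
  feasible.\<close>

lemma (in market) state_price_density_borel_measurable:
  "state_price_density r \<mu> \<sigma> I T \<in> borel_measurable (F T)"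
proof -
  let ?f = "\<lambda>s \<omega>. r s \<omega> + 1 / 2 * (norm (risk_price r \<mu> \<sigma> s \<omega>))\<^sup>2"
  let ?N = "restrict_space borel {0..T} \<Otimes>\<^sub>M F T"
  let ?L = "restrict_space lborel {0..T}"
  have T: "T \<in> {0..T}"
    using T_pos by simp
  have [measurable]: "(\<lambda>x. case x of (s, \<omega>) \<Rightarrow> r s \<omega>) \<in> borel_measurable ?N"
    using r_prog T unfolding progressively_measurable_def by blast
  note [measurable] = risk_price_borel_measurable
  have "(\<lambda>x. (case x of (s, \<omega>) \<Rightarrow> r s \<omega>) + 1 / 2 * (norm (case x of (s, \<omega>) \<Rightarrow> risk_price r \<mu> \<sigma> s \<omega>))\<^sup>2)
      \<in> borel_measurable ?N"
    by measurable
  then have f: "(\<lambda>x. ?f (fst x) (snd x)) \<in> borel_measurable ?N"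
    by (simp add: case_prod_beta)
  \<comment> \<open>The parametrised integral runs over the second coordinate, whereas progressive
    measurability puts time first. \<open>lborel\<close> and \<open>borel\<close> have the same
    measurable sets.\<close>
  have swap: "(\<lambda>x. (snd x, fst x)) \<in> F T \<Otimes>\<^sub>M ?L \<rightarrow>\<^sub>M ?N"
  proof -
    have "sets ?L = sets (restrict_space borel {0..T})"
      by (intro sets_restrict_space_cong) simp
    then have "measurable (F T \<Otimes>\<^sub>M ?L) ?N = measurable (F T \<Otimes>\<^sub>M restrict_space borel {0..T}) ?N"
      by (intro measurable_cong_sets sets_pair_measure_cong) auto
    then show ?thesis
      by simp
  qed
  interpret L: sigma_finite_measure ?L
    by (rule sigma_finite_measure_restrict_space) (auto intro: sigma_finite_lborel)
  have "(\<lambda>\<omega>. LINT s|?L. ?f s \<omega>) \<in> borel_measurable (F T)"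
    using measurable_compose[OF swap f]
    by (intro L.borel_measurable_lebesgue_integral) (simp add: case_prod_beta)
  then have "(\<lambda>\<omega>. LBINT s:{0..T}. ?f s \<omega>) \<in> borel_measurable (F T)"
    by (simp add: set_lebesgue_integral_def integral_restrict_space)
  moreover have "I T \<in> borel_measurable (F T)"
    using I_integral T by (auto simp: has_ito_integral_def)
  ultimately have "(\<lambda>\<omega>. exp (- (LBINT s:{0..T}. ?f s \<omega>) - I T \<omega>)) \<in> borel_measurable (F T)"
    by measurable
  then show ?thesis
    by (simp add: state_price_density_def[abs_def])
qed

section \<open>Pointwise minimisation of the Lagrangian\<close>

lemma pos_part_power_nonneg: "0 \<le> pos_part_power q a"
  by (simp add: pos_part_power_def)

lemma pos_part_power_nonpos: "a \<le> 0 \<Longrightarrow> pos_part_power q a = 0"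
  by (auto simp: pos_part_power_def max_def indicator_def)

lemma pos_part_power_le:
  assumes "q \<le> 1"
  shows "pos_part_power q a \<le> 1 + \<bar>a\<bar>"
  using assms by (cases q) (auto simp: pos_part_power_def indicator_def)

lemma pos_part_power_borel_measurable [measurable]: "pos_part_power q \<in> borel_measurable borel"
  unfolding pos_part_power_def[abs_def] by measurable

text \<open>On [0, \<gamma>] the penalty lies on or above the chord joining its values at 0 and
  \<gamma>, which has slope -\<gamma>^(q-1), and it vanishes beyond \<gamma>. Adding a linear cost t
  x therefore puts the minimum at B, \<gamma> or 0 according as t \<le> 0, 0 < t \<le>
  \<gamma>^(q-1), or t is larger.\<close>

lemma X_opt_minimises_lagrangian:
  fixes x \<gamma> B l \<eta> :: real
  assumes "0 < \<gamma>" "\<gamma> < B" "0 \<le> x" "x \<le> B" "q \<le> 1"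
  shows "pos_part_power q (\<gamma> - X_opt Z q \<gamma> B l \<eta> \<omega>) + (\<eta> * Z \<omega> - l) * X_opt Z q \<gamma> B l \<eta> \<omega>
     \<le> pos_part_power q (\<gamma> - x) + (\<eta> * Z \<omega> - l) * x"
proof -
  define t where "t = \<eta> * Z \<omega> - l"
  define p where "p = \<gamma> powi (int q - 1)"
  have "0 < p"
    using assms(1) by (simp add: p_def)
  \<comment> \<open>In both cases \<open>p * \<gamma>\<close> is the penalty of the payoff 0, so
    \<open>p\<close> is the unit cost at which lifting the payoff from 0 to \<gamma> breaks
    even.\<close>
  have q: "q = 0 \<and> p * \<gamma> = 1 \<or> q = 1 \<and> p = 1"
    using assms(1,5) by (cases q) (auto simp: p_def power_int_minus)
  consider "t \<le> 0" | "0 < t" "t \<le> p" | "p < t"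
    by linarith
  then show ?thesis
  proof cases
    case 1
    then have "X_opt Z q \<gamma> B l \<eta> \<omega> = B"
      using \<open>0 < p\<close> by (simp add: X_opt_def t_def p_def)
    moreover have "t * B \<le> t * x"
      using 1 assms(4) by (simp add: mult_left_mono_neg)
    moreover have "pos_part_power q (\<gamma> - B) = 0"
      using assms(2) by (simp add: pos_part_power_nonpos)
    ultimately show ?thesis
      using pos_part_power_nonneg[of q "\<gamma> - x"] by (simp add: t_def)
  next
    case 2
    then have X: "X_opt Z q \<gamma> B l \<eta> \<omega> = \<gamma>"
      by (simp add: X_opt_def t_def p_def)
    have "t * (\<gamma> - x) \<le> pos_part_power q (\<gamma> - x)"
    proof (cases "x < \<gamma>")
      case True
      have "t * (\<gamma> - x) \<le> p * (\<gamma> - x)"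
        using 2 True by (intro mult_right_mono) auto
      moreover have "p * (\<gamma> - x) \<le> p * \<gamma>"
        using \<open>0 < p\<close> assms(3) by (intro mult_left_mono) auto
      ultimately have "t * (\<gamma> - x) \<le> p * (\<gamma> - x)" "t * (\<gamma> - x) \<le> p * \<gamma>"
        by simp_all
      then show ?thesis
        using q True by (auto simp: pos_part_power_def)
    next
      case False
      then have "t * (\<gamma> - x) \<le> 0"
        using 2 by (simp add: mult_nonneg_nonpos)
      then show ?thesis
        using pos_part_power_nonneg[of q "\<gamma> - x"] by simp
    qed
    moreover have "pos_part_power q 0 = 0"
      by (simp add: pos_part_power_nonpos)
    ultimately show ?thesis
      unfolding X by (simp add: t_def[symmetric] algebra_simps)
  next
    case 3
    then have X: "X_opt Z q \<gamma> B l \<eta> \<omega> = 0"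
      using \<open>0 < p\<close> by (simp add: X_opt_def t_def p_def)
    have px: "p * x \<le> t * x"
      using 3 assms(3) by (intro mult_right_mono) auto
    have "pos_part_power q \<gamma> \<le> pos_part_power q (\<gamma> - x) + t * x"
    proof (cases "x < \<gamma>")
      case True
      have "0 \<le> p * x"
        using \<open>0 < p\<close> assms(3) by simp
      then have "0 \<le> t * x"
        using px by simp
      then show ?thesis
        using q px True assms(1) by (auto simp: pos_part_power_def)
    next
      case False
      then have "p * \<gamma> \<le> p * x"
        using \<open>0 < p\<close> by simp
      then have "p * \<gamma> \<le> t * x"
        using px by simp
      then show ?thesis
        using q assms(1) by (auto simp: pos_part_power_def indicator_def)
    qed
    then show ?thesis
      by (simp add: X t_def)
  qed
qed

lemma X_opt_bounds:
  assumes "0 \<le> \<gamma>" "\<gamma> < B"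
  shows "0 \<le> X_opt Z q \<gamma> B l \<eta> \<omega>" "X_opt Z q \<gamma> B l \<eta> \<omega> \<le> B"
  using assms by (auto simp: X_opt_def indicator_def)

text \<open>A payoff of at least \<gamma> has penalty zero, the least conceivable value of the
  objective.\<close>

lemma safe_set_solves:
  assumes "0 \<le> \<gamma>" "X \<in> safe_set M G Z \<gamma> x0 d B"
  shows "solves M G Z q \<gamma> x0 d B X"
proof -
  have X: "X \<in> L2_set M G" "AE \<omega> in M. \<gamma> \<le> X \<omega> \<and> X \<omega> \<le> B"
    "d \<le> (LINT \<omega>|M. X \<omega>)" "(LINT \<omega>|M. Z \<omega> * X \<omega>) = x0"
    using assms(2) by (auto simp: safe_set_def)
  have "AE \<omega> in M. 0 \<le> X \<omega> \<and> X \<omega> \<le> B"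
    using X(2) by eventually_elim (use assms(1) in auto)
  then have "X \<in> feasible M G Z x0 d B"
    using X by (simp add: feasible_def)
  moreover have "objective M q \<gamma> X = 0"
    unfolding objective_def
    by (intro integral_eq_zero_AE) (use X(2) in \<open>auto elim!: eventually_mono simp: pos_part_power_nonpos\<close>)
  moreover have "0 \<le> objective M q \<gamma> Y" for Y
    unfolding objective_def by (intro integral_nonneg_AE) (simp add: pos_part_power_nonneg)
  ultimately show ?thesis
    by (simp add: solves_def)
qed

section \<open>Prices and probabilities of the events Z \<le> y\<close>

text \<open>\<open>ex1_H1\<close> says that \<open>H1\<close> can be inverted on the open interval
  from 0 to E[Z]: \<open>Z\<close> has no atoms, and on the positive reals \<open>H1\<close> is flat
  only at its extreme values.\<close>

locale pricing_kernel = prob_space M for M :: "'a measure" +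
  fixes Z :: "'a \<Rightarrow> real"
  assumes integrable_Z: "integrable M Z"
    and Z_pos: "0 < Z \<omega>"
    and ex1_H1: "0 < v \<Longrightarrow> v < expectation Z \<Longrightarrow> \<exists>!y. 0 < y \<and> H1 M Z y = v"
begin

lemma Z_measurable [measurable]: "Z \<in> borel_measurable M"
  using integrable_Z by simp

lemma integrable_threshold [simp]: "integrable M (\<lambda>\<omega>. indicator A (Z \<omega>) :: real)" if "A \<in> sets borel"
  by (rule integrable_const_bound[where B = 1]) (use that in \<open>auto simp: indicator_def\<close>)

lemma integrable_bounded_mult_Z:
  assumes [measurable]: "X \<in> borel_measurable M" and "AE \<omega> in M. \<bar>X \<omega>\<bar> \<le> C"
  shows "integrable M (\<lambda>\<omega>. Z \<omega> * X \<omega>)"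
proof (rule Bochner_Integration.integrable_bound)
  show "integrable M (\<lambda>\<omega>. C * Z \<omega>)"
    using integrable_Z by simp
  show "AE \<omega> in M. norm (Z \<omega> * X \<omega>) \<le> norm (C * Z \<omega>)"
    using assms(2)
  proof eventually_elim
    case (elim \<omega>)
    then show ?case
      using Z_pos[of \<omega>] by (simp add: abs_mult)
  qed
qed measurable

lemma integrable_Z_threshold [simp]:
  "integrable M (\<lambda>\<omega>. Z \<omega> * indicator A (Z \<omega>))" if [measurable]: "A \<in> sets borel"
  by (rule integrable_bounded_mult_Z[where C = 1]) (auto simp: indicator_def)

lemma H0_eq_expectation: "H0 M Z y = expectation (\<lambda>\<omega>. indicator {..y} (Z \<omega>))"
proof -
  have "expectation (\<lambda>\<omega>. indicator {..y} (Z \<omega>)) = expectation (indicator {\<omega> \<in> space M. Z \<omega> \<le> y})"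
    by (intro Bochner_Integration.integral_cong) (auto simp: indicator_def)
  also have "\<dots> = H0 M Z y"
    by (simp add: H0_def Int_def conj_commute cong: conj_cong)
  finally show ?thesis ..
qed

lemma expectation_Z_pos: "0 < expectation Z"
proof -
  have "expectation Z \<noteq> 0"
  proof
    assume "expectation Z = 0"
    then have "AE \<omega> in M. Z \<omega> = 0"
      using integral_nonneg_eq_0_iff_AE[OF integrable_Z] Z_pos by (simp add: less_imp_le)
    then show False
      using Z_pos by (simp add: less_le)
  qed
  moreover have "0 \<le> expectation Z"
    using Z_pos by (simp add: less_imp_le)
  ultimately show ?thesis by simp
qed

lemma H1_mono: "a \<le> b \<Longrightarrow> H1 M Z a \<le> H1 M Z b"
  unfolding H1_def using Z_pos
  by (intro integral_mono) (auto split: split_indicator intro: less_imp_le)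

lemma H1_nonneg: "0 \<le> H1 M Z y"
  unfolding H1_def using Z_pos
  by (intro integral_nonneg_AE) (auto simp: indicator_def less_imp_le)

lemma H1_le_expectation: "H1 M Z y \<le> expectation Z"
  unfolding H1_def using Z_pos integrable_Z
  by (intro integral_mono) (auto split: split_indicator intro: less_imp_le)

lemma H1_eq_0_nonpos: "y \<le> 0 \<Longrightarrow> H1 M Z y = 0"
proof -
  assume "y \<le> 0"
  then have "Z \<omega> * indicator {..y} (Z \<omega>) = 0" for \<omega>
    using Z_pos[of \<omega>] by (auto simp: indicator_def)
  then show ?thesis
    unfolding H1_def by (subst integral_eq_zero_AE) auto
qed

text \<open>Since \<open>Z\<close> is positive, an event of price zero is null.\<close>

lemma H0_eq_0:
  assumes "H1 M Z y = 0"
  shows "H0 M Z y = 0"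
proof -
  have "AE \<omega> in M. Z \<omega> * indicator {..y} (Z \<omega>) = 0"
    using assms integral_nonneg_eq_0_iff_AE[of M "\<lambda>\<omega>. Z \<omega> * indicator {..y} (Z \<omega>)"] Z_pos
    by (simp add: H1_def less_imp_le)
  then have "AE \<omega> in M. indicator {..y} (Z \<omega>) = (0 :: real)"
    by eventually_elim (use Z_pos in \<open>metis less_irrefl mult_eq_0_iff\<close>)
  then show ?thesis
    unfolding H0_eq_expectation by (intro integral_eq_zero_AE)
qed

text \<open>The complementary event has price zero and is therefore null.\<close>

lemma H0_eq_1:
  assumes "H1 M Z y = expectation Z"
  shows "H0 M Z y = 1"
proof -
  have int: "integrable M (\<lambda>\<omega>. Z \<omega> - Z \<omega> * indicator {..y} (Z \<omega>))"
    using integrable_Z by simp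
  have "expectation (\<lambda>\<omega>. Z \<omega> - Z \<omega> * indicator {..y} (Z \<omega>)) = 0"
    using assms integrable_Z by (simp add: H1_def)
  then have "AE \<omega> in M. Z \<omega> - Z \<omega> * indicator {..y} (Z \<omega>) = 0"
    using integral_nonneg_eq_0_iff_AE[OF int] Z_pos
    by (auto simp: indicator_def less_imp_le)
  then have "AE \<omega> in M. Z \<omega> \<le> y"
  proof eventually_elim
    case (elim \<omega>)
    then show ?case
      using Z_pos[of \<omega>] by (auto simp: indicator_def split: if_splits)
  qed
  then show ?thesis
    unfolding H0_def by (intro prob_eq_1[THEN iffD2]) auto
qed

text \<open>At v = 0 the preimage need not be unique, since every nonnegative level below the
  essential infimum of \<open>Z\<close> has \<open>H1\<close> equal to 0. Hence the level is pinned
  down only through its value under \<open>H1\<close> and its sign.\<close>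

lemma H1_inv:
  assumes "0 \<le> v" "v < expectation Z"
  shows "H1 M Z (H1_inv M Z v) = v" "0 \<le> H1_inv M Z v"
proof -
  have "v \<in> H1 M Z ` {0..}"
  proof (cases "v = 0")
    case True
    then have "v = H1 M Z 0"
      using H1_eq_0_nonpos by simp
    then show ?thesis
      by (rule image_eqI) simp
  next
    case False
    then have "0 < v"
      using assms(1) by simp
    then obtain y where "0 < y" "H1 M Z y = v"
      using ex1_H1 assms(2) by blast
    then show ?thesis
      by (intro image_eqI[of _ _ y]) auto
  qed
  then have "H1 M Z (H1_inv M Z v) = v \<and> H1_inv M Z v \<in> {0..}"
    unfolding H1_inv_def by (intro conjI f_inv_into_f inv_into_into)
  then show "H1 M Z (H1_inv M Z v) = v" "0 \<le> H1_inv M Z v"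
    by simp_all
qed

lemma H1_inv_pos:
  assumes "0 < v" "v < expectation Z"
  shows "0 < H1_inv M Z v"
  using H1_inv[of v] H1_eq_0_nonpos[of "H1_inv M Z v"] assms by (cases "H1_inv M Z v \<le> 0") auto

lemma pos_if_H1_pos: "0 < H1 M Z y \<Longrightarrow> 0 < y"
  using H1_eq_0_nonpos[of y] by (cases "y \<le> 0") auto

text \<open>\<open>ex1_H1\<close> gives uniqueness among positive levels; a positive value of
  \<open>H1\<close> guarantees that the level is positive.\<close>

lemma H1_inject:
  assumes "H1 M Z a = H1 M Z b" "0 < H1 M Z a" "H1 M Z a < expectation Z"
  shows "a = b"
  using ex1_H1[OF assms(2,3)] pos_if_H1_pos assms by metis

lemma H1_inv_H1:
  assumes "0 < H1 M Z a" "H1 M Z a < expectation Z"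
  shows "H1_inv M Z (H1 M Z a) = a"
  using H1_inject[of "H1_inv M Z (H1 M Z a)" a] H1_inv(1)[of "H1 M Z a"] assms by simp

lemma less_if_H1_less: "H1 M Z a < H1 M Z b \<Longrightarrow> a < b"
  using H1_mono[of b a] by (meson not_less)

lemma H1_inv_mono:
  assumes "0 \<le> u" "u < v" "v < expectation Z"
  shows "H1_inv M Z u < H1_inv M Z v"
  using H1_inv(1)[of u] H1_inv(1)[of v] assms by (simp add: less_if_H1_less)

text \<open>In the states a < Z \<le> b a unit of probability costs between a and b. These exchange
  rates between price and probability are what \<open>two_step_strict\<close> compares.\<close>

lemma H1_increment_le:
  assumes "a \<le> b"
  shows "a * (H0 M Z b - H0 M Z a) \<le> H1 M Z b - H1 M Z a"
    and "H1 M Z b - H1 M Z a \<le> b * (H0 M Z b - H0 M Z a)"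
proof -
  let ?i = "\<lambda>y \<omega>. indicator {..y} (Z \<omega>) :: real"
  have H0: "expectation (\<lambda>\<omega>. c * (?i b \<omega> - ?i a \<omega>)) = c * (H0 M Z b - H0 M Z a)" for c
    by (simp add: H0_eq_expectation)
  have H1: "expectation (\<lambda>\<omega>. Z \<omega> * ?i b \<omega> - Z \<omega> * ?i a \<omega>) = H1 M Z b - H1 M Z a"
    by (simp add: H1_def)
  show "a * (H0 M Z b - H0 M Z a) \<le> H1 M Z b - H1 M Z a"
    unfolding H0[symmetric] H1[symmetric] using assms
    by (intro integral_mono) (auto split: split_indicator)
  show "H1 M Z b - H1 M Z a \<le> b * (H0 M Z b - H0 M Z a)"
    unfolding H0[symmetric] H1[symmetric] using assms
    by (intro integral_mono) (auto split: split_indicator)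
qed

lemma two_step_expectation:
  fixes p c :: real
  shows "expectation (\<lambda>\<omega>. p * indicator {..a} (Z \<omega>) + c * indicator {..b} (Z \<omega>))
      = p * H0 M Z a + c * H0 M Z b"
    and "expectation (\<lambda>\<omega>. Z \<omega> * (p * indicator {..a} (Z \<omega>) + c * indicator {..b} (Z \<omega>)))
      = p * H1 M Z a + c * H1 M Z b"
proof -
  show "expectation (\<lambda>\<omega>. p * indicator {..a} (Z \<omega>) + c * indicator {..b} (Z \<omega>))
      = p * H0 M Z a + c * H0 M Z b"
    by (simp add: H0_eq_expectation)
  have "expectation (\<lambda>\<omega>. Z \<omega> * (p * indicator {..a} (Z \<omega>) + c * indicator {..b} (Z \<omega>)))
      = expectation (\<lambda>\<omega>. p * (Z \<omega> * indicator {..a} (Z \<omega>)) + c * (Z \<omega> * indicator {..b} (Z \<omega>)))"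
    by (intro Bochner_Integration.integral_cong) (auto simp: algebra_simps)
  then show "expectation (\<lambda>\<omega>. Z \<omega> * (p * indicator {..a} (Z \<omega>) + c * indicator {..b} (Z \<omega>)))
      = p * H1 M Z a + c * H1 M Z b"
    by (simp add: H1_def)
qed

section \<open>Continuity of the probability as a function of the budget\<close>

text \<open>Since \<open>H0 \<delta>\<close> tends to \<open>0\<close> with \<open>\<delta>\<close>, this bounds the probability of an event by its price
uniformly, and so makes the mean continuous as a function of the budget.\<close>

lemma prob_le_H0_add:
  assumes [measurable]: "S \<in> events" and "0 < \<delta>"
  shows "prob S \<le> H0 M Z \<delta> + expectation (\<lambda>\<omega>. Z \<omega> * indicator S \<omega>) / \<delta>"
proof -
  have int: "integrable M (\<lambda>\<omega>. Z \<omega> * indicator S \<omega>)"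
    by (rule integrable_bounded_mult_Z[where C = 1]) (auto simp: indicator_def)
  have "prob S = expectation (indicator S)"
    by simp
  also have "\<dots> \<le> expectation (\<lambda>\<omega>. indicator {..\<delta>} (Z \<omega>) + Z \<omega> * indicator S \<omega> / \<delta>)"
  proof (rule integral_mono)
    fix \<omega>
    \<comment> \<open>Markov's inequality pointwise: a state of \<open>S\<close> with Z > \<delta>
      contributes Z / \<delta> > 1.\<close>
    show "indicator S \<omega> \<le> indicator {..\<delta>} (Z \<omega>) + Z \<omega> * indicator S \<omega> / \<delta>"
      using assms(2) Z_pos[of \<omega>] by (auto simp: indicator_def)
  qed (use int in \<open>auto intro!: integrable_real_indicator simp: emeasure_finite less_top[symmetric]\<close>)
  also have "\<dots> = H0 M Z \<delta> + expectation (\<lambda>\<omega>. Z \<omega> * indicator S \<omega>) / \<delta>"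
    using int by (simp add: H0_eq_expectation)
  finally show ?thesis .
qed

text \<open>Continuity from above: \<open>Z\<close> is positive everywhere, so the events Z \<le>
  1/(n+1) decrease to the empty set.\<close>

lemma H0_small:
  assumes "0 < \<epsilon>"
  obtains \<delta> where "0 < \<delta>" "H0 M Z \<delta> < \<epsilon>"
proof -
  let ?A = "\<lambda>n. {\<omega> \<in> space M. Z \<omega> \<le> 1 / real (Suc n)}"
  have "(\<lambda>n. measure M (?A n)) \<longlonglongrightarrow> measure M (\<Inter>n. ?A n)"
  proof (rule finite_Lim_measure_decseq)
    show "decseq ?A"
    proof (rule decseq_SucI, rule subsetI)
      fix n \<omega> assume "\<omega> \<in> ?A (Suc n)"
      moreover have "1 / real (Suc (Suc n)) \<le> 1 / real (Suc n)"
        by (simp add: field_simps)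
      ultimately show "\<omega> \<in> ?A n"
        by auto
    qed
  qed auto
  moreover have "(\<Inter>n. ?A n) = {}"
  proof -
    have "\<exists>n. \<not> Z \<omega> \<le> 1 / real (Suc n)" for \<omega>
      using reals_Archimedean[OF Z_pos[of \<omega>]] by (auto simp: inverse_eq_divide not_le)
    then show ?thesis
      by auto
  qed
  ultimately have "(\<lambda>n. H0 M Z (1 / real (Suc n))) \<longlonglongrightarrow> 0"
    by (simp add: H0_def)
  then have "eventually (\<lambda>n. H0 M Z (1 / real (Suc n)) < \<epsilon>) sequentially"
    using assms by (rule order_tendstoD)
  then obtain n where "H0 M Z (1 / real (Suc n)) < \<epsilon>"
    by (auto simp: eventually_sequentially)
  then show ?thesis
    by (intro that[of "1 / real (Suc n)"]) auto
qed

text \<open>The most likely event of price \<open>v\<close>. The endpoints are treated separately because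
\<open>H1_inv\<close> is a junk value at \<open>E[Z]\<close> when \<open>Z\<close> is unbounded.\<close>

definition cheap :: "real \<Rightarrow> 'a set" where
  "cheap v = (if v \<le> 0 then {} else if expectation Z \<le> v then space M
     else {\<omega> \<in> space M. Z \<omega> \<le> H1_inv M Z v})"

lemma cheap_measurable [measurable]: "cheap v \<in> events"
  by (simp add: cheap_def)

lemma cheap_mono:
  assumes "u \<le> v"
  shows "cheap u \<subseteq> cheap v"
proof (cases "u = v")
  case False
  then have "H1_inv M Z u < H1_inv M Z v" if "0 < u" "v < expectation Z"
    using that assms by (intro H1_inv_mono) auto
  then show ?thesis
    using assms expectation_Z_pos unfolding cheap_def
    by (cases "u \<le> 0"; cases "expectation Z \<le> v") auto
qed simp

lemma integrable_Z_indicator [simp]: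
  "S \<in> events \<Longrightarrow> integrable M (\<lambda>\<omega>. Z \<omega> * indicator S \<omega>)"
  by (rule integrable_bounded_mult_Z[where C = 1]) (auto simp: indicator_def)

text \<open>With the price itself as parameter of \<open>cheap\<close>, the budget constraint
  becomes a linear relation between the two parameters in \<open>two_step_exists\<close>.\<close>

lemma expectation_cheap:
  assumes "0 \<le> v" "v \<le> expectation Z"
  shows "expectation (\<lambda>\<omega>. Z \<omega> * indicator (cheap v) \<omega>) = v"
proof -
  consider "v = 0" | "v = expectation Z" "v \<noteq> 0" | "0 < v" "v < expectation Z"
    using assms by linarith
  then show ?thesis
  proof cases
    case 1
    then show ?thesis by (simp add: cheap_def)
  next
    case 2
    then have "expectation (\<lambda>\<omega>. Z \<omega> * indicator (cheap v) \<omega>) = expectation Z"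
      using assms by (intro Bochner_Integration.integral_cong) (auto simp: cheap_def)
    then show ?thesis
      using 2 by simp
  next
    case 3
    have "expectation (\<lambda>\<omega>. Z \<omega> * indicator (cheap v) \<omega>) = H1 M Z (H1_inv M Z v)"
      unfolding H1_def using 3
      by (intro Bochner_Integration.integral_cong) (auto simp: cheap_def indicator_def)
    then show ?thesis
      using 3 H1_inv(1)[of v] by simp
  qed
qed

text \<open>At v = 0 the two events may differ, because \<open>cheap 0\<close> is empty, but the
  level set then has price zero and so probability zero.\<close>

lemma prob_cheap: "0 \<le> v \<Longrightarrow> v < expectation Z \<Longrightarrow> prob (cheap v) = H0 M Z (H1_inv M Z v)"
  using H1_inv(1)[of v] H0_eq_0[of "H1_inv M Z v"] expectation_Z_pos
  by (cases "v = 0") (auto simp: cheap_def H0_def)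

lemma prob_cheap_expectation: "prob (cheap (expectation Z)) = 1"
  using expectation_Z_pos by (simp add: cheap_def prob_space)

text \<open>The events are nested, so two of them differ by an event whose price is the difference
  of the parameters, and \<open>prob_le_H0_add\<close> bounds its probability. First \<delta> is
  chosen to make \<open>H0\<close> small, then the parameters are taken close relative to
  \<delta>.\<close>

lemma continuous_prob_cheap: "continuous_on {0..expectation Z} (\<lambda>v. prob (cheap v))"
proof -
  have mod: "\<bar>prob (cheap u) - prob (cheap v)\<bar> \<le> H0 M Z \<delta> + \<bar>u - v\<bar> / \<delta>"
    if "0 < \<delta>" "0 \<le> u" "u \<le> v" "v \<le> expectation Z" for u v \<delta>
  proof -
    have "prob (cheap v) - prob (cheap u) = prob (cheap v - cheap u)"
      using that cheap_mono by (intro finite_measure_Diff[symmetric]) auto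
    also have "\<dots> \<le> H0 M Z \<delta> + expectation (\<lambda>\<omega>. Z \<omega> * indicator (cheap v - cheap u) \<omega>) / \<delta>"
      using that(1) by (intro prob_le_H0_add) auto
    also have "expectation (\<lambda>\<omega>. Z \<omega> * indicator (cheap v - cheap u) \<omega>)
        = expectation (\<lambda>\<omega>. Z \<omega> * indicator (cheap v) \<omega> - Z \<omega> * indicator (cheap u) \<omega>)"
      using cheap_mono[OF that(3)]
      by (intro Bochner_Integration.integral_cong) (auto simp: indicator_def)
    also have "\<dots> = v - u"
      using that by (simp add: expectation_cheap)
    finally have "prob (cheap v) - prob (cheap u) \<le> H0 M Z \<delta> + (v - u) / \<delta>" .
    moreover have "prob (cheap u) \<le> prob (cheap v)"
      using cheap_mono[OF that(3)] by (intro finite_measure_mono) auto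
    ultimately show ?thesis
      using that(3) by simp
  qed
  show ?thesis
    unfolding continuous_on_iff dist_real_def
  proof (intro ballI allI impI)
    fix u \<epsilon> :: real assume u: "u \<in> {0..expectation Z}" and "0 < \<epsilon>"
    then obtain \<delta> where \<delta>: "0 < \<delta>" "H0 M Z \<delta> < \<epsilon> / 2"
      using H0_small[of "\<epsilon> / 2"] by auto
    have "\<bar>prob (cheap v) - prob (cheap u)\<bar> < \<epsilon>"
      if v: "v \<in> {0..expectation Z}" "\<bar>v - u\<bar> < \<delta> * (\<epsilon> / 2)" for v
    proof -
      have "\<bar>prob (cheap v) - prob (cheap u)\<bar> \<le> H0 M Z \<delta> + \<bar>v - u\<bar> / \<delta>"
        using mod[OF \<delta>(1), of u v] mod[OF \<delta>(1), of v u] u v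
        by (cases "u \<le> v") (auto simp: abs_minus_commute)
      moreover have "\<bar>v - u\<bar> / \<delta> < \<epsilon> / 2"
        using v(2) \<delta>(1) by (simp add: field_simps)
      ultimately show ?thesis
        using \<delta>(2) by linarith
    qed
    then show "\<exists>d>0. \<forall>v\<in>{0..expectation Z}. \<bar>v - u\<bar> < d \<longrightarrow> \<bar>prob (cheap v) - prob (cheap u)\<bar> < \<epsilon>"
      using \<delta>(1) \<open>0 < \<epsilon>\<close> by (intro exI[of _ "\<delta> * (\<epsilon> / 2)"]) auto
  qed
qed


section \<open>Optimality by Lagrangian duality\<close>

lemma bounded_in_L2_set:
  assumes "subalgebra M G" "X \<in> borel_measurable G" "AE \<omega> in M. 0 \<le> X \<omega> \<and> X \<omega> \<le> B"
  shows "X \<in> L2_set M G"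
proof -
  have [measurable]: "X \<in> borel_measurable M"
    using assms(1,2) by (rule measurable_from_subalg)
  have "integrable M (\<lambda>\<omega>. (X \<omega>)\<^sup>2)"
  proof (rule integrable_const_bound[where B = "B\<^sup>2"])
    show "AE \<omega> in M. norm ((X \<omega>)\<^sup>2) \<le> B\<^sup>2"
      using assms(3) by eventually_elim (auto intro: power_mono)
  qed measurable
  then show ?thesis
    using assms(2) by (simp add: L2_set_def)
qed

lemma lagrangian_expectation:
  assumes [measurable]: "Y \<in> borel_measurable M" and "AE \<omega> in M. 0 \<le> Y \<omega> \<and> Y \<omega> \<le> B" and "q \<le> 1"
  shows "integrable M (\<lambda>\<omega>. pos_part_power q (\<gamma> - Y \<omega>) + (\<eta> * Z \<omega> - l) * Y \<omega>)"
    and "expectation (\<lambda>\<omega>. pos_part_power q (\<gamma> - Y \<omega>) + (\<eta> * Z \<omega> - l) * Y \<omega>)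
      = objective M q \<gamma> Y + \<eta> * expectation (\<lambda>\<omega>. Z \<omega> * Y \<omega>) - l * expectation Y"
proof -
  have "integrable M (\<lambda>\<omega>. pos_part_power q (\<gamma> - Y \<omega>))"
  proof (rule integrable_const_bound[where B = "1 + (\<bar>\<gamma>\<bar> + B)"])
    show "AE \<omega> in M. norm (pos_part_power q (\<gamma> - Y \<omega>)) \<le> 1 + (\<bar>\<gamma>\<bar> + B)"
      using assms(2)
    proof eventually_elim
      case (elim \<omega>)
      then show ?case
        using pos_part_power_le[OF assms(3), of "\<gamma> - Y \<omega>"] pos_part_power_nonneg[of q "\<gamma> - Y \<omega>"] by auto
    qed
  qed measurable
  moreover have "integrable M Y"
    using assms(2) by (intro integrable_const_bound[where B = B]) (auto elim: eventually_mono)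
  moreover have "integrable M (\<lambda>\<omega>. Z \<omega> * Y \<omega>)"
    using assms(2) by (intro integrable_bounded_mult_Z[where C = B]) (auto elim: eventually_mono)
  moreover have "(\<lambda>\<omega>. pos_part_power q (\<gamma> - Y \<omega>) + (\<eta> * Z \<omega> - l) * Y \<omega>)
      = (\<lambda>\<omega>. pos_part_power q (\<gamma> - Y \<omega>) + \<eta> * (Z \<omega> * Y \<omega>) - l * Y \<omega>)"
    by (simp add: fun_eq_iff algebra_simps)
  ultimately show "integrable M (\<lambda>\<omega>. pos_part_power q (\<gamma> - Y \<omega>) + (\<eta> * Z \<omega> - l) * Y \<omega>)"
    and "expectation (\<lambda>\<omega>. pos_part_power q (\<gamma> - Y \<omega>) + (\<eta> * Z \<omega> - l) * Y \<omega>)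
      = objective M q \<gamma> Y + \<eta> * expectation (\<lambda>\<omega>. Z \<omega> * Y \<omega>) - l * expectation Y"
    by (simp_all add: objective_def)
qed

text \<open>Integrating the pointwise minimality compares the Lagrangians of two payoffs. Their
  budget terms agree because both cost \<open>x0\<close>, and the mean terms are handled by
  complementary slackness, \<open>l * E[X] = l * d\<close>. This form covers a binding mean
  constraint as well as l = 0.\<close>

lemma X_opt_solves:
  assumes "subalgebra M G" and [measurable]: "Z \<in> borel_measurable G"
    and "0 < \<gamma>" "\<gamma> < B" "q \<le> 1" "0 \<le> l"
    and d: "d \<le> expectation (X_opt Z q \<gamma> B l \<eta>)" "l * expectation (X_opt Z q \<gamma> B l \<eta>) = l * d"
    and x0: "expectation (\<lambda>\<omega>. Z \<omega> * X_opt Z q \<gamma> B l \<eta> \<omega>) = x0"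
  shows "solves M G Z q \<gamma> x0 d B (X_opt Z q \<gamma> B l \<eta>)"
proof -
  let ?X = "X_opt Z q \<gamma> B l \<eta>"
  have "?X \<in> borel_measurable G"
    unfolding X_opt_def[abs_def] by measurable
  moreover have bounds: "AE \<omega> in M. 0 \<le> ?X \<omega> \<and> ?X \<omega> \<le> B"
    using assms(3,4) by (intro AE_I2 conjI X_opt_bounds) auto
  ultimately have feasible: "?X \<in> feasible M G Z x0 d B"
    using bounded_in_L2_set assms by (simp add: feasible_def)
  have XM: "?X \<in> borel_measurable M"
    using assms(1) \<open>?X \<in> borel_measurable G\<close> by (rule measurable_from_subalg)
  have "objective M q \<gamma> ?X \<le> objective M q \<gamma> Y" if "Y \<in> feasible M G Z x0 d B" for Y
  proof -
    have Y: "Y \<in> borel_measurable M" "AE \<omega> in M. 0 \<le> Y \<omega> \<and> Y \<omega> \<le> B" "d \<le> expectation Y"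
      "expectation (\<lambda>\<omega>. Z \<omega> * Y \<omega>) = x0"
      using that measurable_from_subalg[OF assms(1)] by (auto simp: feasible_def L2_set_def)
    have "expectation (\<lambda>\<omega>. pos_part_power q (\<gamma> - ?X \<omega>) + (\<eta> * Z \<omega> - l) * ?X \<omega>)
        \<le> expectation (\<lambda>\<omega>. pos_part_power q (\<gamma> - Y \<omega>) + (\<eta> * Z \<omega> - l) * Y \<omega>)"
    proof (rule integral_mono_AE)
      show "AE \<omega> in M. pos_part_power q (\<gamma> - ?X \<omega>) + (\<eta> * Z \<omega> - l) * ?X \<omega>
          \<le> pos_part_power q (\<gamma> - Y \<omega>) + (\<eta> * Z \<omega> - l) * Y \<omega>"
        using Y(2) by eventually_elim (use assms(3-5) in \<open>auto intro: X_opt_minimises_lagrangian\<close>)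
    qed (use lagrangian_expectation(1) XM bounds Y assms(5) in auto)
    then have "objective M q \<gamma> ?X - l * d \<le> objective M q \<gamma> Y - l * expectation Y"
      using lagrangian_expectation(2)[OF XM bounds assms(5)] lagrangian_expectation(2)[OF Y(1,2) assms(5)]
        x0 Y(4) d(2) by simp
    moreover have "l * d \<le> l * expectation Y"
      using Y(3) assms(6) by (rule mult_left_mono)
    ultimately show ?thesis
      by linarith
  qed
  then show ?thesis
    using feasible by (simp add: solves_def)
qed

section \<open>Thresholds on the budget line: uniqueness\<close>

lemma X_opt_expectation:
  fixes l \<eta> \<gamma> B :: real and q :: nat
  assumes "0 < \<eta>"
  defines "a \<equiv> l / \<eta>" and "b \<equiv> (l + \<gamma> powi (int q - 1)) / \<eta>"
  shows "expectation (X_opt Z q \<gamma> B l \<eta>) = (B - \<gamma>) * H0 M Z a + \<gamma> * H0 M Z b"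
    and "expectation (\<lambda>\<omega>. Z \<omega> * X_opt Z q \<gamma> B l \<eta> \<omega>) = (B - \<gamma>) * H1 M Z a + \<gamma> * H1 M Z b"
proof -
  have "X_opt Z q \<gamma> B l \<eta> = (\<lambda>\<omega>. (B - \<gamma>) * indicator {..a} (Z \<omega>) + \<gamma> * indicator {..b} (Z \<omega>))"
    using assms(1) by (auto simp: X_opt_def fun_eq_iff indicator_def a_def b_def field_simps)
  then show "expectation (X_opt Z q \<gamma> B l \<eta>) = (B - \<gamma>) * H0 M Z a + \<gamma> * H0 M Z b"
    and "expectation (\<lambda>\<omega>. Z \<omega> * X_opt Z q \<gamma> B l \<eta> \<omega>) = (B - \<gamma>) * H1 M Z a + \<gamma> * H1 M Z b"
    by (simp_all only: two_step_expectation)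
qed

text \<open>If the upper step covers almost every state, or the lower step almost none, the payoff
  is the extreme one whose mean is \<open>d_lower\<close>; both are excluded by
  \<open>d_lower\<close> < d. The thresholds thus stay where \<open>H1\<close> is injective.\<close>

lemma two_step_interior:
  assumes "0 < \<gamma>" "\<gamma> < B" "0 < x0" "x0 < B * expectation Z" "d_lower M Z x0 \<gamma> B < d"
    and d: "(B - \<gamma>) * H0 M Z a + \<gamma> * H0 M Z b = d"
    and x0: "(B - \<gamma>) * H1 M Z a + \<gamma> * H1 M Z b = x0"
  shows "0 < H1 M Z a" "H1 M Z b < expectation Z"
proof -
  have d_lower_if_top: "d_lower M Z x0 \<gamma> B = d" if "H1 M Z b = expectation Z"
  proof -
    have v: "(x0 - \<gamma> * expectation Z) / (B - \<gamma>) = H1 M Z a"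
      using that x0 assms(2) by (simp add: field_simps)
    have "0 \<le> (B - \<gamma>) * H1 M Z a"
      using H1_nonneg assms(2) by simp
    then have ge: "\<not> x0 < \<gamma> * expectation Z"
      using x0 that by simp
    have "(B - \<gamma>) * H1 M Z a < (B - \<gamma>) * expectation Z"
      using x0 that assms(4) by (simp add: algebra_simps)
    then have lt: "H1 M Z a < expectation Z"
      using assms(2) by simp
    \<comment> \<open>At price zero \<open>H1_inv\<close> may return a level other than
      \<open>a\<close>, but both levels have probability zero.\<close>
    have "H0 M Z (H1_inv M Z (H1 M Z a)) = H0 M Z a"
    proof (cases "H1 M Z a = 0")
      case True
      then show ?thesis
        using H1_inv(1)[of 0] expectation_Z_pos by (simp add: H0_eq_0)
    next
      case False
      then show ?thesis
        using H1_inv_H1[of a] H1_nonneg[of a] lt by simp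
    qed
    then show ?thesis
      using d ge v H0_eq_1[OF that] by (simp add: d_lower_def)
  qed
  have top: "H1 M Z b \<noteq> expectation Z"
    using d_lower_if_top assms(5) by auto
  then show lt: "H1 M Z b < expectation Z"
    using H1_le_expectation[of b] by simp
  have "H1 M Z a \<noteq> 0"
  proof
    assume a: "H1 M Z a = 0"
    have v: "x0 / \<gamma> = H1 M Z b"
      using x0 a assms(1) by (simp add: field_simps)
    then have "H1_inv M Z (x0 / \<gamma>) = b"
      using lt assms(1,3) by (metis H1_inv_H1 zero_less_divide_iff)
    moreover have "x0 < \<gamma> * expectation Z"
      using v lt assms(1) by (simp add: field_simps)
    ultimately have "d_lower M Z x0 \<gamma> B = \<gamma> * H0 M Z b"
      by (simp add: d_lower_def)
    then show False
      using d assms(5) H0_eq_0[OF a] by simp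
  qed
  then show "0 < H1 M Z a"
    using H1_nonneg[of a] by simp
qed

text \<open>Moving budget from the expensive states around \<open>b\<close> to the cheap states around \<open>a\<close> buys more
expected payoff.\<close>

lemma two_step_strict:
  assumes "0 < \<gamma>" "\<gamma> < B" "a < a'" "a' < b'"
    and "0 < H1 M Z a" "H1 M Z a < expectation Z"
    and eq: "(B - \<gamma>) * H1 M Z a + \<gamma> * H1 M Z b = (B - \<gamma>) * H1 M Z a' + \<gamma> * H1 M Z b'"
  shows "(B - \<gamma>) * H0 M Z a + \<gamma> * H0 M Z b < (B - \<gamma>) * H0 M Z a' + \<gamma> * H0 M Z b'"
proof -
  \<comment> \<open>\<open>K\<close> is the budget moved from the upper step to the lower
    one.\<close>
  define K where "K = (B - \<gamma>) * (H1 M Z a' - H1 M Z a)"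
  have K: "K = \<gamma> * (H1 M Z b - H1 M Z b')"
    using eq by (simp add: K_def algebra_simps)
  have "H1 M Z a < H1 M Z a'"
    using H1_inject[of a a'] H1_mono[of a a'] assms by force
  then have "0 < K"
    using assms(2) by (simp add: K_def)
  then have "b' < b"
    using K assms(1) by (simp add: zero_less_mult_iff less_if_H1_less)
  have "0 < a'"
    using pos_if_H1_pos assms(3,5) by force
  have "(B - \<gamma>) * (H1 M Z a' - H1 M Z a) \<le> (B - \<gamma>) * (a' * (H0 M Z a' - H0 M Z a))"
    using H1_increment_le(2)[of a a'] assms by (intro mult_left_mono) auto
  \<comment> \<open>The states gained cost at most \<open>a'\<close> per unit, so \<open>K\<close>
    buys at least \<open>K / a'\<close> of mean.\<close>
  then have up: "K / a' \<le> (B - \<gamma>) * (H0 M Z a' - H0 M Z a)"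
    using \<open>0 < a'\<close> by (simp add: K_def field_simps)
  have "\<gamma> * (b' * (H0 M Z b - H0 M Z b')) \<le> \<gamma> * (H1 M Z b - H1 M Z b')"
    using H1_increment_le(1)[of b' b] \<open>b' < b\<close> assms(1) by (intro mult_left_mono) auto
  \<comment> \<open>The states given up cost at least \<open>b'\<close> per unit, so at most
    \<open>K / b'\<close> of mean is lost.\<close>
  then have down: "\<gamma> * (H0 M Z b - H0 M Z b') \<le> K / b'"
    using \<open>0 < a'\<close> assms(4) by (simp add: K field_simps)
  have "K / b' < K / a'"
    using \<open>0 < K\<close> \<open>0 < a'\<close> assms(4) by (intro divide_strict_left_mono) auto
  then show ?thesis
    using up down by (simp add: algebra_simps)
qed

text \<open>By \<open>two_step_strict\<close>, different lower thresholds would give different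
  means. Once they agree, the budget determines \<open>H1\<close> at the upper threshold, where
  \<open>H1\<close> is injective.\<close>

lemma two_step_unique:
  assumes "0 < \<gamma>" "\<gamma> < B" "0 < x0" "x0 < B * expectation Z" "d_lower M Z x0 \<gamma> B < d"
    and "a < b" "(B - \<gamma>) * H0 M Z a + \<gamma> * H0 M Z b = d" "(B - \<gamma>) * H1 M Z a + \<gamma> * H1 M Z b = x0"
    and "a' < b'" "(B - \<gamma>) * H0 M Z a' + \<gamma> * H0 M Z b' = d"
      "(B - \<gamma>) * H1 M Z a' + \<gamma> * H1 M Z b' = x0"
  shows "a = a' \<and> b = b'"
proof -
  note int = two_step_interior[OF assms(1-5,7,8)] and int' = two_step_interior[OF assms(1-5,10,11)]
  have H1ab: "H1 M Z a \<le> H1 M Z b" "H1 M Z a' \<le> H1 M Z b'"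
    using H1_mono assms(6,9) by simp_all
  have "\<not> a < a'"
    using two_step_strict[of \<gamma> B a a' b' b] int H1ab assms by auto
  moreover have "\<not> a' < a"
    using two_step_strict[of \<gamma> B a' a b b'] int' H1ab assms by auto
  ultimately have "a = a'"
    by simp
  have "\<gamma> * H1 M Z b = \<gamma> * H1 M Z b'"
    using assms(8,11) unfolding \<open>a = a'\<close> by linarith
  then have "H1 M Z b = H1 M Z b'"
    using assms(1) by simp
  then have "b = b'"
    using H1_inject[of b b'] int H1ab by simp
  then show ?thesis
    using \<open>a = a'\<close> by simp
qed

section \<open>The range of attainable means: existence of thresholds\<close>

text \<open>A Neyman-Pearson argument. For \<gamma> \<le> 0 the digital payoff with mean
  \<open>d_upper\<close> takes its values in [\<gamma>, B] and costs \<open>x0\<close>. Among such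
  payoffs the one paying B on Z \<le> c and \<gamma> elsewhere has the largest mean, and that mean
  is \<open>d_lower\<close>.\<close>

lemma d_upper_le_d_lower:
  assumes "\<gamma> \<le> 0" "0 < x0" "0 < B" "x0 < B * expectation Z"
  shows "d_upper M Z x0 B \<le> d_lower M Z x0 \<gamma> B"
proof -
  define a where "a = H1_inv M Z (x0 / B)"
  define v where "v = (x0 - \<gamma> * expectation Z) / (B - \<gamma>)"
  define c where "c = H1_inv M Z v"
  have \<gamma>EZ: "\<gamma> * expectation Z \<le> 0"
    using assms(1) expectation_Z_pos by (simp add: mult_nonpos_nonneg)
  have a: "B * H1 M Z a = x0"
    using H1_inv(1)[of "x0 / B"] assms by (simp add: a_def field_simps)
  have v: "0 < v" "v < expectation Z"
    using assms \<gamma>EZ by (auto simp: v_def field_simps)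
  then have c: "(B - \<gamma>) * H1 M Z c = x0 - \<gamma> * expectation Z" "0 < c"
    using H1_inv(1)[of v] H1_inv_pos[of v] assms by (simp_all add: c_def) (simp add: v_def)
  have "c * B * H0 M Z a - x0
      = expectation (\<lambda>\<omega>. c * (B * indicator {..a} (Z \<omega>)) - B * (Z \<omega> * indicator {..a} (Z \<omega>)))"
    using a by (simp add: H0_eq_expectation H1_def)
  also have "\<dots> \<le> expectation (\<lambda>\<omega>. c * ((B - \<gamma>) * indicator {..c} (Z \<omega>) + \<gamma>)
      - ((B - \<gamma>) * (Z \<omega> * indicator {..c} (Z \<omega>)) + \<gamma> * Z \<omega>))"
  proof (rule integral_mono)
    fix \<omega>
    \<comment> \<open>For each state the right-hand payoff maximises (c - Z) x over x in
      [\<gamma>, B]. After integration the two costs cancel.\<close>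
    have "(c - Z \<omega>) * (B * indicator {..a} (Z \<omega>)) \<le> (c - Z \<omega>) * ((B - \<gamma>) * indicator {..c} (Z \<omega>) + \<gamma>)"
    proof (cases "Z \<omega> \<le> c")
      case True
      then show ?thesis
        using assms by (intro mult_left_mono) (auto simp: indicator_def)
    next
      case False
      then show ?thesis
        using assms by (intro mult_left_mono_neg) (auto simp: indicator_def)
    qed
    then show "c * (B * indicator {..a} (Z \<omega>)) - B * (Z \<omega> * indicator {..a} (Z \<omega>))
        \<le> c * ((B - \<gamma>) * indicator {..c} (Z \<omega>) + \<gamma>) - ((B - \<gamma>) * (Z \<omega> * indicator {..c} (Z \<omega>)) + \<gamma> * Z \<omega>)"
      by (simp add: algebra_simps)
  qed (use integrable_Z in simp_all)
  also have "\<dots> = c * ((B - \<gamma>) * H0 M Z c + \<gamma>) - ((B - \<gamma>) * H1 M Z c + \<gamma> * expectation Z)"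
    using integrable_Z by (simp add: H0_eq_expectation H1_def prob_space)
  also have "\<dots> = c * ((B - \<gamma>) * H0 M Z c + \<gamma>) - x0"
    using c by simp
  finally have "c * (B * H0 M Z a) \<le> c * ((B - \<gamma>) * H0 M Z c + \<gamma>)"
    by simp
  then have "B * H0 M Z a \<le> (B - \<gamma>) * H0 M Z c + \<gamma>"
    using c(2) by simp
  then show ?thesis
    using \<gamma>EZ assms(2) by (simp add: d_upper_def d_lower_def a_def c_def v_def)
qed

lemma two_step_exists:
  assumes "0 < \<gamma>" "\<gamma> < B" "0 < x0" "x0 < B * expectation Z"
    and "d_lower M Z x0 \<gamma> B < d" "d < d_upper M Z x0 B"
  shows "\<exists>a b. 0 < a \<and> a < b \<and> (B - \<gamma>) * H0 M Z a + \<gamma> * H0 M Z b = d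
      \<and> (B - \<gamma>) * H1 M Z a + \<gamma> * H1 M Z b = x0"
proof -
  \<comment> \<open>The budget line is parametrised by the price \<open>u\<close> of the lower
    event; \<open>w u\<close> is the price left for the upper event, and \<open>g u\<close> is the
    resulting mean.\<close>
  define w where "w u = (x0 - (B - \<gamma>) * u) / \<gamma>" for u
  define g where "g u = (B - \<gamma>) * prob (cheap u) + \<gamma> * prob (cheap (w u))" for u
  \<comment> \<open>Below \<open>lo\<close> either \<open>u\<close> would be negative or
    \<open>w u\<close> would exceed E[Z]. At \<open>hi\<close> the two prices coincide.\<close>
  define lo where "lo = max 0 ((x0 - \<gamma> * expectation Z) / (B - \<gamma>))"
  define hi where "hi = x0 / B"
  have hi: "0 < hi" "hi < expectation Z" "w hi = hi"
    using assms by (auto simp: hi_def w_def field_simps)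
  have lo_le: "lo \<le> hi"
  proof -
    have "(x0 - \<gamma> * expectation Z) * B \<le> x0 * (B - \<gamma>)"
      using assms by (simp add: algebra_simps)
    then show ?thesis
      using assms hi(1) by (simp add: lo_def hi_def field_simps)
  qed
  have w_less: "w u < w u'" if "u' < u" for u u'
    using that assms by (simp add: w_def divide_strict_right_mono)
  have w_lo_le: "w lo \<le> expectation Z"
  proof -
    have "(x0 - \<gamma> * expectation Z) / (B - \<gamma>) \<le> lo"
      by (simp add: lo_def)
    then have "x0 - \<gamma> * expectation Z \<le> lo * (B - \<gamma>)"
      using assms by (simp add: pos_divide_le_eq)
    then show ?thesis
      using assms by (simp add: w_def pos_divide_le_eq algebra_simps)
  qed
  have w_range: "w u \<in> {0..expectation Z}" if "u \<in> {lo..hi}" for u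
    using that w_less[of u hi] w_less[of lo u] w_less[of u lo] w_less[of hi u] hi w_lo_le by fastforce
  have "continuous_on {lo..hi} g"
    unfolding g_def
  proof (intro continuous_intros)
    show "continuous_on {lo..hi} (\<lambda>u. prob (cheap u))"
      using hi by (intro continuous_on_subset[OF continuous_prob_cheap]) (auto simp: lo_def)
    show "continuous_on {lo..hi} (\<lambda>u. prob (cheap (w u)))"
      using w_range assms
      by (intro continuous_on_compose2[OF continuous_prob_cheap]) (auto simp: w_def intro!: continuous_intros)
  qed
  \<comment> \<open>The two branches of \<open>d_lower\<close> correspond to which constraint
    defines \<open>lo\<close>: an empty lower event, or an upper event that is the whole
    space.\<close>
  moreover have g_lo: "g lo = d_lower M Z x0 \<gamma> B"
  proof (cases "x0 < \<gamma> * expectation Z")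
    case True
    then have "lo = 0"
      using assms by (simp add: lo_def max_def divide_le_0_iff zero_le_divide_iff)
    moreover have "0 < x0 / \<gamma>" "x0 / \<gamma> < expectation Z"
      using True assms by (simp_all add: field_simps)
    moreover have "prob (cheap 0) = 0"
      by (simp add: cheap_def)
    ultimately show ?thesis
      using True prob_cheap[of "x0 / \<gamma>"] by (simp add: g_def w_def d_lower_def)
  next
    case False
    then have lo: "lo = (x0 - \<gamma> * expectation Z) / (B - \<gamma>)"
      using assms by (simp add: lo_def)
    then have "w lo = expectation Z"
      using assms by (simp add: w_def)
    moreover have "prob (cheap lo) = H0 M Z (H1_inv M Z lo)"
      using lo_le hi by (intro prob_cheap) (auto simp: lo_def)
    ultimately show ?thesis
      using False by (simp add: g_def d_lower_def prob_cheap_expectation lo[symmetric])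
  qed
  moreover have g_hi: "g hi = d_upper M Z x0 B"
    using hi prob_cheap[of hi] by (simp add: g_def d_upper_def hi_def[symmetric] algebra_simps)
  ultimately obtain u where u: "lo \<le> u" "u \<le> hi" "g u = d"
    using IVT'[of g lo d hi] assms(5,6) lo_le by auto
  \<comment> \<open>The strict bounds on \<open>d\<close> exclude the endpoints, so both prices lie
    strictly between 0 and E[Z] and \<open>cheap\<close> is given there by genuine values of
    \<open>H1_inv\<close>.\<close>
  then have strict: "lo < u" "u < hi"
    using assms(5,6) g_lo g_hi by (auto simp: less_le)
  have ord: "0 < u" "u < w u" "w u < expectation Z"
    using strict(1) w_less[OF strict(2)] strict(2) hi(3) w_less[OF strict(1)] w_lo_le
    by (simp add: lo_def, linarith, linarith)
  have "(B - \<gamma>) * u + \<gamma> * w u = x0"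
    using assms(1) by (simp add: w_def)
  then show ?thesis
    using ord u(3) H1_inv_pos[of u] H1_inv_mono[of u "w u"] H1_inv(1)[of u] H1_inv(1)[of "w u"]
      prob_cheap[of u] prob_cheap[of "w u"]
    by (intro exI[of _ "H1_inv M Z u"] exI[of _ "H1_inv M Z (w u)"]) (simp add: g_def)
qed


section \<open>From thresholds to multipliers and explicit solutions\<close>

lemma X_opt_parameters_ex1:
  assumes "0 < \<gamma>" "\<gamma> < B" "0 < x0" "x0 < B * expectation Z"
    and "d_lower M Z x0 \<gamma> B < d" "d < d_upper M Z x0 B"
  shows "\<exists>!(l, \<eta>). 0 < l \<and> 0 < \<eta> \<and>
    expectation (X_opt Z q \<gamma> B l \<eta>) = d \<and> expectation (\<lambda>\<omega>. Z \<omega> * X_opt Z q \<gamma> B l \<eta> \<omega>) = x0"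
proof -
  define p where "p = \<gamma> powi (int q - 1)"
  have "0 < p"
    using assms(1) by (simp add: p_def)
  let ?P = "\<lambda>l \<eta>. 0 < l \<and> 0 < \<eta> \<and>
    expectation (X_opt Z q \<gamma> B l \<eta>) = d \<and> expectation (\<lambda>\<omega>. Z \<omega> * X_opt Z q \<gamma> B l \<eta> \<omega>) = x0"
  obtain a b where ab: "0 < a" "a < b" "(B - \<gamma>) * H0 M Z a + \<gamma> * H0 M Z b = d"
    "(B - \<gamma>) * H1 M Z a + \<gamma> * H1 M Z b = x0"
    using two_step_exists[OF assms] by blast
  \<comment> \<open>The thresholds l / \<eta> and (l + p) / \<eta> differ by p / \<eta>, which fixes
    \<eta>; the lower one then gives l = a \<eta>.\<close>
  define \<eta> where "\<eta> = p / (b - a)"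
  have "0 < \<eta>"
    using ab \<open>0 < p\<close> by (simp add: \<eta>_def)
  moreover have "a * \<eta> / \<eta> = a" "(a * \<eta> + p) / \<eta> = b"
    using ab \<open>0 < p\<close> by (simp_all add: \<eta>_def field_simps)
  ultimately have ex: "?P (a * \<eta>) \<eta>"
    using ab by (simp add: X_opt_expectation p_def)
  have uniq: "l = l' \<and> \<eta> = \<eta>'" if P: "?P l \<eta>" and P': "?P l' \<eta>'" for l \<eta> l' \<eta>'
  proof -
    have less: "l / \<eta> < (l + p) / \<eta>" "l' / \<eta>' < (l' + p) / \<eta>'"
      using that \<open>0 < p\<close> by (simp_all add: divide_strict_right_mono)
    have "l / \<eta> = l' / \<eta>' \<and> (l + p) / \<eta> = (l' + p) / \<eta>'"
    proof (rule two_step_unique[OF assms(1-5) less(1) _ _ less(2)])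
      show "(B - \<gamma>) * H0 M Z (l / \<eta>) + \<gamma> * H0 M Z ((l + p) / \<eta>) = d"
        "(B - \<gamma>) * H1 M Z (l / \<eta>) + \<gamma> * H1 M Z ((l + p) / \<eta>) = x0"
        using P X_opt_expectation[where \<eta> = \<eta> and l = l and \<gamma> = \<gamma> and B = B and q = q]
        unfolding p_def by simp_all
      show "(B - \<gamma>) * H0 M Z (l' / \<eta>') + \<gamma> * H0 M Z ((l' + p) / \<eta>') = d"
        "(B - \<gamma>) * H1 M Z (l' / \<eta>') + \<gamma> * H1 M Z ((l' + p) / \<eta>') = x0"
        using P' X_opt_expectation[where \<eta> = \<eta>' and l = l' and \<gamma> = \<gamma> and B = B and q = q]
        unfolding p_def by simp_all
    qed
    \<comment> \<open>Subtracting the thresholds leaves the gap p / \<eta>, from which \<eta> and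
      then l are recovered.\<close>
    then have eq: "l / \<eta> = l' / \<eta>'" "p / \<eta> = p / \<eta>'"
      unfolding add_divide_distrib by linarith+
    then have "\<eta> = \<eta>'"
      using \<open>0 < p\<close> P P' by (simp add: field_simps)
    then show ?thesis
      using eq(1) P by simp
  qed
  show ?thesis
  proof (rule ex1I)
    show "case (a * \<eta>, \<eta>) of (l, \<eta>) \<Rightarrow> ?P l \<eta>"
      using ex by simp
  next
    fix y assume "case y of (l, \<eta>) \<Rightarrow> ?P l \<eta>"
    then show "y = (a * \<eta>, \<eta>)"
      using uniq[OF _ ex] unfolding case_prod_beta prod_eq_iff fst_conv snd_conv by blast
  qed
qed

text \<open>For l = 0 the lower threshold is 0 and its event is empty because Z > 0. What remains
  pays \<gamma> up to the level at which this exhausts \<open>x0\<close>.\<close>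

lemma X_opt_zero_multiplier:
  fixes \<gamma> x0 :: real and q :: nat
  assumes "0 < \<gamma>" "0 < x0" "x0 < \<gamma> * expectation Z"
  defines "\<eta> \<equiv> \<gamma> powi (int q - 1) / H1_inv M Z (x0 / \<gamma>)"
  shows "0 < \<eta>"
    and "expectation (X_opt Z q \<gamma> B 0 \<eta>) = d_lower M Z x0 \<gamma> B"
    and "expectation (\<lambda>\<omega>. Z \<omega> * X_opt Z q \<gamma> B 0 \<eta> \<omega>) = x0"
proof -
  define b where "b = H1_inv M Z (x0 / \<gamma>)"
  have "0 < x0 / \<gamma>" "x0 / \<gamma> < expectation Z"
    using assms by (simp_all add: field_simps)
  then have b: "0 < b" "H1 M Z b = x0 / \<gamma>"
    using H1_inv_pos[of "x0 / \<gamma>"] H1_inv(1)[of "x0 / \<gamma>"] by (simp_all add: b_def)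
  then show "0 < \<eta>"
    using assms(1) by (simp add: \<eta>_def b_def[symmetric])
  moreover have "\<gamma> powi (int q - 1) / \<eta> = b"
    using assms(1) b by (simp add: \<eta>_def b_def[symmetric])
  moreover have "H1 M Z 0 = 0" "H0 M Z 0 = 0"
    using H1_eq_0_nonpos[of 0] H0_eq_0[of 0] by simp_all
  ultimately show "expectation (X_opt Z q \<gamma> B 0 \<eta>) = d_lower M Z x0 \<gamma> B"
    and "expectation (\<lambda>\<omega>. Z \<omega> * X_opt Z q \<gamma> B 0 \<eta> \<omega>) = x0"
    using assms(1,3) b by (simp_all add: X_opt_expectation d_lower_def b_def[symmetric])
qed

text \<open>Securing \<gamma> in every state costs \<gamma> E[Z]; the rest of \<open>x0\<close> buys
  the extra B - \<gamma> in the cheapest states, which yields the mean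
  \<open>d_lower\<close>.\<close>

lemma x_star_in_safe_set:
  assumes "subalgebra M G" and [measurable]: "Z \<in> borel_measurable G"
    and "0 \<le> \<gamma>" "\<gamma> < B" "\<gamma> * expectation Z \<le> x0" "x0 < B * expectation Z" "d \<le> d_lower M Z x0 \<gamma> B"
  shows "x_star M Z \<gamma> x0 B \<in> safe_set M G Z \<gamma> x0 d B"
proof -
  define v where "v = (x0 - \<gamma> * expectation Z) / (B - \<gamma>)"
  define c where "c = H1_inv M Z v"
  have x_star: "x_star M Z \<gamma> x0 B = (\<lambda>\<omega>. (B - \<gamma>) * indicator {..c} (Z \<omega>) + \<gamma>)"
    by (simp add: x_star_def fun_eq_iff c_def v_def)
  have bounds: "\<gamma> \<le> x_star M Z \<gamma> x0 B \<omega>" "x_star M Z \<gamma> x0 B \<omega> \<le> B" for \<omega>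
    using assms(4) by (simp_all add: x_star indicator_def)
  have "x_star M Z \<gamma> x0 B \<in> borel_measurable G"
    unfolding x_star by measurable
  moreover have "AE \<omega> in M. 0 \<le> x_star M Z \<gamma> x0 B \<omega> \<and> x_star M Z \<gamma> x0 B \<omega> \<le> B"
    using bounds assms(3) order_trans by (intro AE_I2) blast
  ultimately have "x_star M Z \<gamma> x0 B \<in> L2_set M G"
    by (rule bounded_in_L2_set[OF assms(1)])
  moreover have "0 \<le> v" "v < expectation Z"
    using assms by (simp_all add: v_def field_simps)
  then have "H1 M Z c = v"
    by (simp add: c_def H1_inv)
  moreover have "expectation (x_star M Z \<gamma> x0 B) = (B - \<gamma>) * H0 M Z c + \<gamma>"
    by (simp add: x_star H0_eq_expectation prob_space)
  then have "expectation (x_star M Z \<gamma> x0 B) = d_lower M Z x0 \<gamma> B"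
    using assms(5) by (simp add: d_lower_def c_def v_def)
  moreover have "expectation (\<lambda>\<omega>. Z \<omega> * x_star M Z \<gamma> x0 B \<omega>)
      = expectation (\<lambda>\<omega>. (B - \<gamma>) * (Z \<omega> * indicator {..c} (Z \<omega>)) + \<gamma> * Z \<omega>)"
    by (simp add: x_star algebra_simps)
  then have "expectation (\<lambda>\<omega>. Z \<omega> * x_star M Z \<gamma> x0 B \<omega>) = (B - \<gamma>) * H1 M Z c + \<gamma> * expectation Z"
    using integrable_Z by (simp add: H1_def)
  ultimately show ?thesis
    using bounds assms(4,7) by (simp add: safe_set_def v_def)
qed

end

section \<open>The three regimes of the target mean\<close>

text \<open>The bounds on \<open>x0\<close> place \<open>x0 / B\<close> strictly between 0 and E[Z].
  The third claim is restricted to \<gamma> \<ge> 0: for negative \<gamma>, \<open>x_star\<close> is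
  negative with positive probability and so violates the constraint X \<ge> 0.\<close>

theorem mainTheorem2:
  fixes M :: "'a measure" and F :: "real \<Rightarrow> 'a measure" and T :: real
    and W :: "real \<Rightarrow> 'a \<Rightarrow> real ^ 'n"
    and r :: "real \<Rightarrow> 'a \<Rightarrow> real"
    and \<mu> :: "real \<Rightarrow> 'a \<Rightarrow> real ^ 'n"
    and \<sigma> :: "real \<Rightarrow> 'a \<Rightarrow> real ^ 'n ^ 'n"
    and I :: "real \<Rightarrow> 'a \<Rightarrow> real"
    and x0 d \<gamma> B x_safe :: real and q :: nat
  defines "Z \<equiv> state_price_density r \<mu> \<sigma> I T"
  assumes "market M F T W r \<mu> \<sigma> I"
    and "integrable M Z"
    and "\<forall>v. 0 < v \<and> v < (LINT \<omega>|M. Z \<omega>) \<longrightarrow> (\<exists>!y. 0 < y \<and> H1 M Z y = v)"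
    and "0 < x0"
    and "max d (max x_safe \<gamma>) < B"
    and "x0 < B * (LINT \<omega>|M. Z \<omega>)"
    and "q \<le> 1"
  shows
    "(d_lower M Z x0 \<gamma> B < d \<and> d < d_upper M Z x0 B \<longrightarrow>
        (\<exists>!(l, \<eta>). 0 < l \<and> 0 < \<eta> \<and>
           (LINT \<omega>|M. X_opt Z q \<gamma> B l \<eta> \<omega>) = d \<and>
           (LINT \<omega>|M. Z \<omega> * X_opt Z q \<gamma> B l \<eta> \<omega>) = x0) \<and>
        (\<forall>l \<eta>. 0 < l \<and> 0 < \<eta> \<and>
           (LINT \<omega>|M. X_opt Z q \<gamma> B l \<eta> \<omega>) = d \<and>
           (LINT \<omega>|M. Z \<omega> * X_opt Z q \<gamma> B l \<eta> \<omega>) = x0 \<longrightarrow>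
           solves M (F T) Z q \<gamma> x0 d B (X_opt Z q \<gamma> B l \<eta>)))
     \<and>
     (d \<le> d_lower M Z x0 \<gamma> B \<and> x0 < \<gamma> * (LINT \<omega>|M. Z \<omega>) \<longrightarrow>
        (let \<eta> = \<gamma> powi (int q - 1) / H1_inv M Z (x0 / \<gamma>) in
           0 < \<eta> \<and>
           solves M (F T) Z q \<gamma> x0 d B (X_opt Z q \<gamma> B 0 \<eta>) \<and>
           (LINT \<omega>|M. X_opt Z q \<gamma> B 0 \<eta> \<omega>) \<ge> d \<and>
           (LINT \<omega>|M. Z \<omega> * X_opt Z q \<gamma> B 0 \<eta> \<omega>) = x0))
     \<and>
     (d \<le> d_lower M Z x0 \<gamma> B \<and> x0 \<ge> \<gamma> * (LINT \<omega>|M. Z \<omega>) \<and> 0 \<le> \<gamma> \<longrightarrow>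
        safe_set M (F T) Z \<gamma> x0 d B \<noteq> {} \<and>
        (\<forall>X\<in>safe_set M (F T) Z \<gamma> x0 d B. solves M (F T) Z q \<gamma> x0 d B X) \<and>
        x_star M Z \<gamma> x0 B \<in> safe_set M (F T) Z \<gamma> x0 d B)"
proof -
  interpret market M F T W r \<mu> \<sigma> I
    by fact
  have Z_meas: "Z \<in> borel_measurable (F T)"
    unfolding Z_def by (rule state_price_density_borel_measurable)
  have Z_pos: "0 < Z \<omega>" for \<omega>
    by (simp add: Z_def state_price_density_def)
  interpret pricing_kernel M Z
    using assms(3,4) Z_pos by unfold_locales auto
  have B: "\<gamma> < B" "d < B" "0 < B"
    using assms(5-7) expectation_Z_pos by (auto simp: zero_less_mult_iff dest: less_trans)
  show ?thesis
  proof (intro conjI impI)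
    assume d: "d_lower M Z x0 \<gamma> B < d \<and> d < d_upper M Z x0 B"
    \<comment> \<open>For \<gamma> \<le> 0 no \<open>d\<close> lies strictly between the two
      bounds.\<close>
    then have "0 < \<gamma>"
      using d_upper_le_d_lower[of \<gamma> x0 B] B assms(5,7) by (meson not_le order.strict_trans)
    then show "\<exists>!(l, \<eta>). 0 < l \<and> 0 < \<eta> \<and>
        (LINT \<omega>|M. X_opt Z q \<gamma> B l \<eta> \<omega>) = d \<and>
        (LINT \<omega>|M. Z \<omega> * X_opt Z q \<gamma> B l \<eta> \<omega>) = x0"
      using X_opt_parameters_ex1 d B assms(5,7) by simp
    show "\<forall>l \<eta>. 0 < l \<and> 0 < \<eta> \<and>
        (LINT \<omega>|M. X_opt Z q \<gamma> B l \<eta> \<omega>) = d \<and>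
        (LINT \<omega>|M. Z \<omega> * X_opt Z q \<gamma> B l \<eta> \<omega>) = x0 \<longrightarrow>
        solves M (F T) Z q \<gamma> x0 d B (X_opt Z q \<gamma> B l \<eta>)"
      using X_opt_solves[OF subalgebra_F Z_meas \<open>0 < \<gamma>\<close> B(1) assms(8)] by simp
  next
    assume d: "d \<le> d_lower M Z x0 \<gamma> B \<and> x0 < \<gamma> * (LINT \<omega>|M. Z \<omega>)"
    then have "0 < \<gamma> * (LINT \<omega>|M. Z \<omega>)"
      using assms(5) by linarith
    then have \<gamma>: "0 < \<gamma>"
      using expectation_Z_pos by (simp add: zero_less_mult_iff)
    note X = X_opt_zero_multiplier[OF \<gamma> assms(5) conjunct2[OF d], of q]
    show "let \<eta> = \<gamma> powi (int q - 1) / H1_inv M Z (x0 / \<gamma>) in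
        0 < \<eta> \<and>
        solves M (F T) Z q \<gamma> x0 d B (X_opt Z q \<gamma> B 0 \<eta>) \<and>
        (LINT \<omega>|M. X_opt Z q \<gamma> B 0 \<eta> \<omega>) \<ge> d \<and>
        (LINT \<omega>|M. Z \<omega> * X_opt Z q \<gamma> B 0 \<eta> \<omega>) = x0"
      \<comment> \<open>With l = 0 complementary slackness is trivial, so a mean of at least
        \<open>d\<close> suffices.\<close>
      using X X_opt_solves[OF subalgebra_F Z_meas \<gamma> B(1) assms(8)] d by (simp add: Let_def)
  next
    assume d: "d \<le> d_lower M Z x0 \<gamma> B \<and> x0 \<ge> \<gamma> * (LINT \<omega>|M. Z \<omega>) \<and> 0 \<le> \<gamma>"
    then show star: "x_star M Z \<gamma> x0 B \<in> safe_set M (F T) Z \<gamma> x0 d B"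
      using x_star_in_safe_set[OF subalgebra_F Z_meas] B assms(7) by simp
    then show "safe_set M (F T) Z \<gamma> x0 d B \<noteq> {}"
      by blast
    show "\<forall>X\<in>safe_set M (F T) Z \<gamma> x0 d B. solves M (F T) Z q \<gamma> x0 d B X"
      using d safe_set_solves by blast
  qed
qed

end
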